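(* For $n\ge1$ let $(X_n,H_n):(\Omega_n,\mathcal F_n,\mathbb P_n)\to C([0,T];\mathbb R^d)^2$ be random variables, defined on probability spaces $(\Omega_n,\mathcal F_n,\mathbb P_n)$, such that the sequence $(X_n,H_n)_{n\ge1}$ converges in distribution to a random variable $(X,H):(\Omega,\mathcal F,\mathbb P)\to C([0,T];\mathbb R^d)^2$. If for all $n\ge1$, $H_n$ is $\mathbb P_n$-a.s. of bounded variation and $$\lim_{\nu\to+\infty}\sup_{n\ge1}\mathbb P_n\big(\|H_n\|_{BV([0,T];\mathbb R^d)}>\nu\big)=0,$$ then $H$ is $\mathbb P$-a.s. of bounded variation and the sequence of $C[0,T]$-valued random variables $\big(\int_0^{\cdot}\langle X_n(s),dH_n(s)\rangle\big)_{n\ge1}$ converges in distribution to $\int_0^{\cdot}\langle X(s),dH(s)\rangle$.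
   Context: $T>0$, $d\in\mathbb N^*$. $C([0,T];\mathbb R^d)$ is the Banach space of continuous functions with the sup-norm (with its Borel $\sigma$-algebra), and $C[0,T]:=C([0,T];\mathbb R)$. For $\eta:[0,T]\to\mathbb R^d$ the total variation is $\mathrm V_0^T(\eta):=\sup\sum_{i}|\eta(t_i)-\eta(t_{i-1})|$, the supremum over all partitions $0=t_0<t_1<\dots<t_k=T$; $\|\eta\|_{BV([0,T];\mathbb R^d)}:=|\eta(0)|+\mathrm V_0^T(\eta)$ (equal to $+\infty$ if $\eta$ is not of bounded variation). For $x$ continuous and $\eta$ continuous of bounded variation, $\int_0^t\langle x(s),d\eta(s)\rangle:=\sum_{i=1}^d\int_0^tx_i(s)\,d\eta_i(s)$ (Lebesgue–Stieltjes integrals of components). On the null events where $H_n$ (or $H$) is not of bounded variation the integral process is set equal to $0$. *)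

theory Defs
  imports "HOL-Probability.Probability"
begin

section \<open>Path spaces and convergence in distribution\<close>

text \<open>Elements are continuous functions on \<open>[0,T]\<close>, made extensional outside \<open>[0,T]\<close>;
  the metric is the sup-distance.\<close>

definition C_top :: "real \<Rightarrow> (real \<Rightarrow> 'v::metric_space) topology" where
  "C_top T = mtopology_of (cfunspace (top_of_set {0..T}) euclidean_metric)"

definition borel_of_top :: "'s topology \<Rightarrow> 's measure" where
  "borel_of_top S = sigma (topspace S) {U. openin S U}"

text \<open>The variables may live on different probability spaces. Their measurability into
  \<^term>\<open>borel_of_top S\<close> is not part of this definition and has to be required separately.\<close>

definition converges_in_distribution ::
  "'s topology \<Rightarrow> (nat \<Rightarrow> 'a measure) \<Rightarrow> (nat \<Rightarrow> 'a \<Rightarrow> 's) \<Rightarrow> 'b measure \<Rightarrow> ('b \<Rightarrow> 's) \<Rightarrow> bool" where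
  "converges_in_distribution S P Z Q Y \<longleftrightarrow>
     (\<forall>f :: 's \<Rightarrow> real. continuous_map S euclideanreal f \<and> bounded (f ` topspace S) \<longrightarrow>
        (\<lambda>n. \<integral>\<omega>. f (Z n \<omega>) \<partial>P n) \<longlonglongrightarrow> (\<integral>\<omega>. f (Y \<omega>) \<partial>Q))"


section \<open>Bounded variation and Stieltjes integrals\<close>

text \<open>A pair \<open>(k, t)\<close> encodes the partition \<open>a = t 0 < \<dots> < t k = b\<close>; \<open>k = 0\<close> occurs only if
  \<open>a = b\<close>.\<close>

definition partitions :: "real \<Rightarrow> real \<Rightarrow> (nat \<times> (nat \<Rightarrow> real)) set" where
  "partitions a b = {(k, t). t 0 = a \<and> t k = b \<and> (\<forall>i<k. t i < t (Suc i))}"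

definition total_variation :: "real \<Rightarrow> real \<Rightarrow> (real \<Rightarrow> 'v::real_normed_vector) \<Rightarrow> ennreal" where
  "total_variation a b \<eta> =
     (SUP (k, t) \<in> partitions a b. ennreal (\<Sum>i<k. norm (\<eta> (t (Suc i)) - \<eta> (t i))))"

definition bounded_variation :: "real \<Rightarrow> (real \<Rightarrow> 'v::real_normed_vector) \<Rightarrow> bool" where
  "bounded_variation T \<eta> \<longleftrightarrow> total_variation 0 T \<eta> < \<infinity>"

definition BV_norm :: "real \<Rightarrow> (real \<Rightarrow> 'v::real_normed_vector) \<Rightarrow> ennreal" where
  "BV_norm T \<eta> = ennreal (norm (\<eta> 0)) + total_variation 0 T \<eta>"

text \<open>The Lebesgue--Stieltjes integral \<open>\<integral>\<^sub>0\<^sup>t x d\<eta>\<close>, for \<open>t \<in> [0,T]\<close> and \<open>\<eta>\<close> continuous of bounded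
  variation on \<open>[0,T]\<close>, via the Jordan decomposition \<open>\<eta> = V - (V - \<eta>)\<close> where \<open>V s\<close> is the
  variation of \<open>\<eta>\<close> on \<open>[0,s]\<close>. Since \<^const>\<open>interval_measure\<close> expects functions on the whole
  real line, the two nondecreasing functions are extended constantly outside \<open>[0,T]\<close>. As \<open>\<eta>\<close> is
  continuous, there are no atoms and the endpoints of \<open>[0,t]\<close> do not matter.\<close>

definition variation_fun :: "real \<Rightarrow> (real \<Rightarrow> real) \<Rightarrow> real \<Rightarrow> real" where
  "variation_fun T \<eta> s = enn2real (total_variation 0 (clamp 0 T s) \<eta>)"

definition stieltjes_integral :: "real \<Rightarrow> (real \<Rightarrow> real) \<Rightarrow> (real \<Rightarrow> real) \<Rightarrow> real \<Rightarrow> real" where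
  "stieltjes_integral T x \<eta> t =
     (LINT s:{0..t}|interval_measure (variation_fun T \<eta>). x s) -
     (LINT s:{0..t}|interval_measure (\<lambda>s. variation_fun T \<eta> s - \<eta> (clamp 0 T s)). x s)"

text \<open>The path \<open>t \<mapsto> \<integral>\<^sub>0\<^sup>t \<langle>x, d\<eta>\<rangle>\<close> in \<open>C[0,T]\<close>; it is the zero path if \<open>\<eta>\<close> is not of
  bounded variation.\<close>

definition integral_process ::
  "real \<Rightarrow> (real \<Rightarrow> real^'d) \<Rightarrow> (real \<Rightarrow> real^'d) \<Rightarrow> real \<Rightarrow> real" where
  "integral_process T x \<eta> = (\<lambda>t\<in>{0..T}.
     if bounded_variation T \<eta>
     then \<Sum>i\<in>UNIV. stieltjes_integral T (\<lambda>s. x s $ i) (\<lambda>s. \<eta> s $ i) t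
     else 0)"

end

theory Submission
  imports Defs
begin

text \<open>The map \<open>(x, \<eta>) \<mapsto> \<integral> \<langle>x, d\<eta>\<rangle>\<close> is not continuous for the sup-norm, but its restriction to
  each set \<open>{\<parallel>\<eta>\<parallel>\<^sub>B\<^sub>V \<le> K}\<close> is: replacing \<open>x\<close> by a step function changes the integral by at most a
  constant times \<open>K\<close> times the oscillation of \<open>x\<close> over the steps, and the integral of a step
  function is a finite sum of increments of \<open>\<eta>\<close>. Since the variation is a supremum of continuous
  functions, these sets are closed, so a bounded continuous test function composed with the
  integral extends by Tietze from such a set to a bounded continuous function of \<open>(x, \<eta>)\<close>. The
  convergence in distribution applies to the extension, and the error is controlled by the
  probability of \<open>{\<parallel>\<eta>\<parallel>\<^sub>B\<^sub>V > K}\<close>, which is uniformly small along the sequence and, this set being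
  open, also in the limit.\<close>

section \<open>Total variation\<close>

lemma partitions_nonempty: "a \<le> b \<Longrightarrow> partitions a b \<noteq> {}"
proof (cases "a = b")
  case True
  then have "(0, \<lambda>_. a) \<in> partitions a b" by (simp add: partitions_def)
  then show ?thesis by blast
next
  case False
  assume "a \<le> b"
  with False have "(1, \<lambda>i. if i = 0 then a else b) \<in> partitions a b"
    by (simp add: partitions_def)
  then show ?thesis by blast
qed

text \<open>Adding \<open>c\<close> as a last point turns a partition of \<open>[a,b]\<close> into
  one of \<open>[a,c]\<close>. Partitions are strictly increasing, so \<open>b = c\<close> is a
  separate, trivial case.\<close>

lemma total_variation_append:
  assumes "a \<le> b" "b \<le> c"
  shows "total_variation a b \<eta> + ennreal (norm (\<eta> c - \<eta> b)) \<le> total_variation a c \<eta>"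
proof (cases "b = c")
  case False
  have "total_variation a b \<eta> + ennreal (norm (\<eta> c - \<eta> b)) =
    (SUP p \<in> partitions a b. (case p of (k, t) \<Rightarrow> ennreal (\<Sum>i<k. norm (\<eta> (t (Suc i)) - \<eta> (t i))))
        + ennreal (norm (\<eta> c - \<eta> b)))"
    unfolding total_variation_def
    by (rule ennreal_SUP_add_left[symmetric]) (use partitions_nonempty[OF assms(1)] in auto)
  also have "\<dots> \<le> total_variation a c \<eta>"
  proof (rule SUP_least, clarify)
    fix k t assume kt: "(k, t) \<in> partitions a b"
    define t' where "t' = t(Suc k := c)"
    have mem: "(Suc k, t') \<in> partitions a c"
      using kt False assms by (auto simp: partitions_def t'_def less_Suc_eq)
    have "(\<Sum>i<Suc k. norm (\<eta> (t' (Suc i)) - \<eta> (t' i))) =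
        (\<Sum>i<k. norm (\<eta> (t (Suc i)) - \<eta> (t i))) + norm (\<eta> c - \<eta> b)"
      using kt by (auto simp: t'_def partitions_def)
    then have "ennreal (\<Sum>i<k. norm (\<eta> (t (Suc i)) - \<eta> (t i))) + ennreal (norm (\<eta> c - \<eta> b)) =
        ennreal (\<Sum>i<Suc k. norm (\<eta> (t' (Suc i)) - \<eta> (t' i)))"
      by (simp add: ennreal_plus[symmetric] sum_nonneg del: ennreal_plus sum.lessThan_Suc)
    also have "\<dots> \<le> total_variation a c \<eta>"
      unfolding total_variation_def by (rule SUP_upper2[OF mem]) auto
    finally show "ennreal (\<Sum>i<k. norm (\<eta> (t (Suc i)) - \<eta> (t i))) + ennreal (norm (\<eta> c - \<eta> b))
      \<le> total_variation a c \<eta>" .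
  qed
  finally show ?thesis .
qed simp

text \<open>Induction on \<open>k\<close>, appending one increment at a time. The points may repeat,
  which lets later proofs truncate partitions freely. The conjunct \<open>a \<le> t k\<close> is
  carried along because each appending step needs it.\<close>

lemma total_variation_add_sum_le:
  assumes "a \<le> t 0" "\<And>i. i < k \<Longrightarrow> t i \<le> t (Suc i)"
  shows "total_variation a (t 0) \<eta> + ennreal (\<Sum>i<k. norm (\<eta> (t (Suc i)) - \<eta> (t i)))
    \<le> total_variation a (t k) \<eta> \<and> a \<le> t k"
  using assms(2)
proof (induction k)
  case 0
  then show ?case using assms(1) by simp
next
  case (Suc k)
  then have IH: "total_variation a (t 0) \<eta> + ennreal (\<Sum>i<k. norm (\<eta> (t (Suc i)) - \<eta> (t i)))
    \<le> total_variation a (t k) \<eta>" "a \<le> t k" by auto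
  have le: "t k \<le> t (Suc k)" using Suc.prems by auto
  have "total_variation a (t 0) \<eta> + ennreal (\<Sum>i<Suc k. norm (\<eta> (t (Suc i)) - \<eta> (t i))) =
    (total_variation a (t 0) \<eta> + ennreal (\<Sum>i<k. norm (\<eta> (t (Suc i)) - \<eta> (t i))))
      + ennreal (norm (\<eta> (t (Suc k)) - \<eta> (t k)))"
    by (simp add: ennreal_plus sum_nonneg add.assoc)
  also have "\<dots> \<le> total_variation a (t k) \<eta> + ennreal (norm (\<eta> (t (Suc k)) - \<eta> (t k)))"
    by (rule add_right_mono[OF IH(1)])
  also have "\<dots> \<le> total_variation a (t (Suc k)) \<eta>"
    by (rule total_variation_append[OF IH(2) le])
  finally show ?case using IH(2) le by auto
qed

lemma sum_le_total_variation:
  assumes "\<And>i. i < k \<Longrightarrow> t i \<le> t (Suc i)"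
  shows "ennreal (\<Sum>i<k. norm (\<eta> (t (Suc i)) - \<eta> (t i))) \<le> total_variation (t 0) (t k) \<eta>"
proof -
  have "0 + ennreal (\<Sum>i<k. norm (\<eta> (t (Suc i)) - \<eta> (t i))) \<le>
    total_variation (t 0) (t 0) \<eta> + ennreal (\<Sum>i<k. norm (\<eta> (t (Suc i)) - \<eta> (t i)))"
    by (rule add_right_mono) simp
  also have "\<dots> \<le> total_variation (t 0) (t k) \<eta>"
    using total_variation_add_sum_le[of "t 0" t k \<eta>] assms by auto
  finally show ?thesis by simp
qed

lemma norm_diff_le_total_variation:
  "a \<le> b \<Longrightarrow> ennreal (norm (\<eta> b - \<eta> a)) \<le> total_variation a b \<eta>"
  using sum_le_total_variation[of 1 "\<lambda>i. if i = 0 then a else b" \<eta>] by simp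

text \<open>For \<open>\<le>\<close>, a partition of \<open>[b,c]\<close> continues any partition of
  \<open>[a,b]\<close>. For \<open>\<ge>\<close>, a partition of \<open>[a,c]\<close> is cut at
  \<open>b\<close> by taking the minimum and the maximum of each point with \<open>b\<close>; both
  cut sequences are weakly increasing, so \<open>b\<close> need not be inserted as a point.\<close>

lemma total_variation_add:
  assumes "a \<le> b" "b \<le> c"
  shows "total_variation a b \<eta> + total_variation b c \<eta> = total_variation a c \<eta>"
proof (rule antisym)
  have "total_variation a b \<eta> + total_variation b c \<eta> =
    (SUP p \<in> partitions b c. total_variation a b \<eta> +
      (case p of (k, t) \<Rightarrow> ennreal (\<Sum>i<k. norm (\<eta> (t (Suc i)) - \<eta> (t i)))))"
    unfolding total_variation_def[of b]
    by (rule ennreal_SUP_add_right[OF partitions_nonempty[OF assms(2)]])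
  also have "\<dots> \<le> total_variation a c \<eta>"
  proof (rule SUP_least, clarify)
    fix k t assume kt: "(k, t) \<in> partitions b c"
    show "total_variation a b \<eta> + ennreal (\<Sum>i<k. norm (\<eta> (t (Suc i)) - \<eta> (t i)))
      \<le> total_variation a c \<eta>"
      using total_variation_add_sum_le[of a t k \<eta>] kt assms
      by (auto simp: partitions_def less_imp_le)
  qed
  finally show "total_variation a b \<eta> + total_variation b c \<eta> \<le> total_variation a c \<eta>" .
next
  show "total_variation a c \<eta> \<le> total_variation a b \<eta> + total_variation b c \<eta>"
    unfolding total_variation_def[of a c]
  proof (rule SUP_least, clarify)
    fix k t assume kt: "(k, t) \<in> partitions a c"
    then have mono: "\<And>i. i < k \<Longrightarrow> t i \<le> t (Suc i)" and t0: "t 0 = a" "t k = c"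
      by (auto simp: partitions_def less_imp_le)
    let ?S = "\<lambda>u. \<Sum>i<k. norm (\<eta> (u (Suc i)) - \<eta> (u i))"
    let ?l = "\<lambda>i. min (t i) b" and ?r = "\<lambda>i. max (t i) b"
    have "?S t \<le> (\<Sum>i<k. norm (\<eta> (?l (Suc i)) - \<eta> (?l i)) + norm (\<eta> (?r (Suc i)) - \<eta> (?r i)))"
    proof (rule sum_mono)
      fix i
      \<comment> \<open>One of \<open>min s b\<close>, \<open>max s b\<close> is \<open>s\<close>
        and the other is \<open>b\<close>, so every increment splits exactly into a left and a right
        one.\<close>
      have *: "\<eta> s = \<eta> (min s b) + \<eta> (max s b) - \<eta> b" for s by (auto simp: min_def max_def)
      have "\<eta> (t (Suc i)) - \<eta> (t i) =
         (\<eta> (?l (Suc i)) - \<eta> (?l i)) + (\<eta> (?r (Suc i)) - \<eta> (?r i))"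
        by (subst (1 2) *) (simp add: algebra_simps)
      then show "norm (\<eta> (t (Suc i)) - \<eta> (t i)) \<le>
         norm (\<eta> (?l (Suc i)) - \<eta> (?l i)) + norm (\<eta> (?r (Suc i)) - \<eta> (?r i))"
        by (simp only: norm_triangle_ineq)
    qed
    then have "?S t \<le> ?S ?l + ?S ?r" by (simp add: sum.distrib)
    then have "ennreal (?S t) \<le> ennreal (?S ?l) + ennreal (?S ?r)"
      by (subst ennreal_plus[symmetric]) (auto intro!: sum_nonneg ennreal_leI)
    also have "\<dots> \<le> total_variation a b \<eta> + total_variation b c \<eta>"
    proof (rule add_mono)
      have "ennreal (?S ?l) \<le> total_variation (?l 0) (?l k) \<eta>"
        by (intro sum_le_total_variation min.mono mono order_refl)
      then show "ennreal (?S ?l) \<le> total_variation a b \<eta>" using t0 assms by (simp add: min_absorb1 min_absorb2)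
      have "ennreal (?S ?r) \<le> total_variation (?r 0) (?r k) \<eta>"
        by (intro sum_le_total_variation max.mono mono order_refl)
      then show "ennreal (?S ?r) \<le> total_variation b c \<eta>" using t0 assms by (simp add: max_absorb1 max_absorb2)
    qed
    finally show "ennreal (?S t) \<le> total_variation a b \<eta> + total_variation b c \<eta>" .
  qed
qed

lemma total_variation_mono:
  assumes "a' \<le> a" "a \<le> b" "b \<le> b'"
  shows "total_variation a b \<eta> \<le> total_variation a' b' \<eta>"
proof -
  have "total_variation a b \<eta> \<le> total_variation a b' \<eta>"
    using total_variation_add[of a b b' \<eta>] assms by (metis le_iff_add)
  also have "\<dots> \<le> total_variation a' b' \<eta>"
    using total_variation_add[of a' a b' \<eta>] assms
    by (metis add.commute le_iff_add order_trans)
  finally show ?thesis .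
qed

section \<open>Semicontinuity of the variation in the end points of the interval\<close>

lemma less_total_variationE:
  assumes "c < total_variation a b \<eta>"
  obtains k t where "\<And>i. i < k \<Longrightarrow> t i \<le> t (Suc i)" "t 0 = a" "t k = b"
    "c < ennreal (\<Sum>i<k. norm (\<eta> (t (Suc i)) - \<eta> (t i)))"
proof -
  obtain p where p: "p \<in> partitions a b"
    "c < (case p of (k, t) \<Rightarrow> ennreal (\<Sum>i<k. norm (\<eta> (t (Suc i)) - \<eta> (t i))))"
    using assms unfolding total_variation_def less_SUP_iff by blast
  obtain k t where [simp]: "p = (k, t)" by force
  show thesis
    using p by (intro that[of k t]) (auto simp: partitions_def less_imp_le)
qed

lemma monotone_steps_bounds:
  fixes t :: "nat \<Rightarrow> real"
  assumes "\<And>i. i < k \<Longrightarrow> t i \<le> t (Suc i)" "i \<le> k"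
  shows "t 0 \<le> t i" "t i \<le> t k"
proof -
  have "t j \<le> t i" if "j \<le> i" "i \<le> k" for i j
    using that
  proof (induction i rule: dec_induct)
    case (step n)
    then show ?case using assms(1)[of n] by simp
  qed simp
  then show "t 0 \<le> t i" "t i \<le> t k" using assms(2) by auto
qed

lemma continuous_on_partition_sum:
  fixes \<eta> :: "real \<Rightarrow> 'v::real_normed_vector"
  assumes "\<And>i. i \<le> k \<Longrightarrow> continuous_on S (\<lambda>u. \<eta> (h u i))"
  shows "continuous_on S (\<lambda>u. ennreal (\<Sum>i<k. norm (\<eta> (h u (Suc i)) - \<eta> (h u i))))"
  by (intro continuous_on_ennreal continuous_on_sum continuous_on_norm continuous_on_diff assms) auto

text \<open>Stopping the path at \<open>u\<close> (or starting it at \<open>u\<close>) makes the partition of \<open>[a,b]\<close> fixed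
  while the end point moves.\<close>

lemma total_variation_lsc_right_endpoint:
  fixes \<eta> :: "real \<Rightarrow> 'v::real_normed_vector"
  assumes cont: "continuous_on {a..b} \<eta>" and s: "s \<in> {a..b}" and c: "c < total_variation a s \<eta>"
  shows "\<forall>\<^sub>F u in at s within {a..b}. c < total_variation a u \<eta>"
proof -
  obtain k t where t: "\<And>i. i < k \<Longrightarrow> t i \<le> t (Suc i)" "t 0 = a" "t k = s"
    "c < ennreal (\<Sum>i<k. norm (\<eta> (t (Suc i)) - \<eta> (t i)))"
    using less_total_variationE[OF c] by metis
  \<comment> \<open>The truncated points still increase weakly from \<open>a\<close>. If
    \<open>u\<close> exceeds \<open>s\<close>, they end at \<open>s\<close> instead of
    \<open>u\<close>, which monotonicity of the variation absorbs.\<close>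
  define h where "h u i = min (t i) u" for u i
  have bds: "a \<le> t i" "t i \<le> s" if "i \<le> k" for i
    using monotone_steps_bounds[of k t i] t that by auto
  let ?g = "\<lambda>u. ennreal (\<Sum>i<k. norm (\<eta> (h u (Suc i)) - \<eta> (h u i)))"
  have "continuous_on {a..b} ?g"
  proof (rule continuous_on_partition_sum)
    fix i assume "i \<le> k"
    then show "continuous_on {a..b} (\<lambda>u. \<eta> (h u i))"
      unfolding h_def using bds[of i]
      by (intro continuous_on_compose2[OF cont] continuous_intros) auto
  qed
  then have "(?g \<longlongrightarrow> ?g s) (at s within {a..b})"
    using s by (auto simp: continuous_on_def)
  moreover have "h s i = t i" if "i \<le> k" for i using bds[OF that] by (simp add: h_def)
  then have "c < ?g s" using t(4) by simp
  ultimately have "\<forall>\<^sub>F u in at s within {a..b}. c < ?g u" by (rule order_tendstoD)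
  moreover have "\<forall>\<^sub>F u in at s within {a..b}. u \<in> {a..b}" by (simp add: eventually_at_filter)
  ultimately show ?thesis
  proof eventually_elim
    case (elim u)
    have "?g u \<le> total_variation (h u 0) (h u k) \<eta>"
      unfolding h_def by (intro sum_le_total_variation min.mono t(1) order_refl)
    also have "\<dots> \<le> total_variation a u \<eta>"
      using elim t s by (intro total_variation_mono) (auto simp: h_def)
    finally show ?case using elim(1) by simp
  qed
qed

lemma total_variation_lsc_left_endpoint:
  fixes \<eta> :: "real \<Rightarrow> 'v::real_normed_vector"
  assumes cont: "continuous_on {a..b} \<eta>" and s: "s \<in> {a..b}" and c: "c < total_variation s b \<eta>"
  shows "\<forall>\<^sub>F u in at s within {a..b}. c < total_variation u b \<eta>"
proof -
  obtain k t where t: "\<And>i. i < k \<Longrightarrow> t i \<le> t (Suc i)" "t 0 = s" "t k = b"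
    "c < ennreal (\<Sum>i<k. norm (\<eta> (t (Suc i)) - \<eta> (t i)))"
    using less_total_variationE[OF c] by metis
  define h where "h u i = max (t i) u" for u i
  have bds: "s \<le> t i" "t i \<le> b" if "i \<le> k" for i
    using monotone_steps_bounds[of k t i] t that by auto
  let ?g = "\<lambda>u. ennreal (\<Sum>i<k. norm (\<eta> (h u (Suc i)) - \<eta> (h u i)))"
  have "continuous_on {a..b} ?g"
  proof (rule continuous_on_partition_sum)
    fix i assume "i \<le> k"
    then show "continuous_on {a..b} (\<lambda>u. \<eta> (h u i))"
      unfolding h_def using bds[of i]
      by (intro continuous_on_compose2[OF cont] continuous_intros) auto
  qed
  then have "(?g \<longlongrightarrow> ?g s) (at s within {a..b})"
    using s by (auto simp: continuous_on_def)
  moreover have "h s i = t i" if "i \<le> k" for i using bds[OF that] by (simp add: h_def)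
  then have "c < ?g s" using t(4) by simp
  ultimately have "\<forall>\<^sub>F u in at s within {a..b}. c < ?g u" by (rule order_tendstoD)
  moreover have "\<forall>\<^sub>F u in at s within {a..b}. u \<in> {a..b}" by (simp add: eventually_at_filter)
  ultimately show ?thesis
  proof eventually_elim
    case (elim u)
    have "?g u \<le> total_variation (h u 0) (h u k) \<eta>"
      unfolding h_def by (intro sum_le_total_variation max.mono t(1) order_refl)
    also have "\<dots> \<le> total_variation u b \<eta>"
      using elim t s by (intro total_variation_mono) (auto simp: h_def)
    finally show ?case using elim(1) by simp
  qed
qed

lemma less_enn2real_iff: "0 \<le> c \<Longrightarrow> x < \<infinity> \<Longrightarrow> c < enn2real x \<longleftrightarrow> ennreal c < x"
  by (cases x rule: ennreal_cases) (auto simp: ennreal_less_iff)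

text \<open>Carries lower semicontinuity from \<open>ennreal\<close> over to the reals. A negative
  \<open>d\<close> is treated apart, since \<open>ennreal d\<close> would be \<open>0\<close>; the
  claim then holds because \<open>enn2real\<close> is nonnegative.\<close>

lemma eventually_less_enn2real:
  assumes "\<And>c. c < f s \<Longrightarrow> \<forall>\<^sub>F u in F. c < f u" "f s < \<infinity>" "\<forall>\<^sub>F u in F. f u < \<infinity>"
    and "d < enn2real (f s)"
  shows "\<forall>\<^sub>F u in F. d < enn2real (f u)"
proof (cases "d < 0")
  case True
  then show ?thesis by (auto intro!: always_eventually less_le_trans[OF True])
next
  case False
  then have "\<forall>\<^sub>F u in F. ennreal d < f u"
    using assms(2,4) by (intro assms(1)) (simp add: less_enn2real_iff)
  then show ?thesis
    using assms(3) by eventually_elim (use False in \<open>simp add: less_enn2real_iff\<close>)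
qed

text \<open>By additivity both \<open>V\<^sub>a\<^sup>s\<close> and \<open>V\<^sub>a\<^sup>b - V\<^sub>a\<^sup>s = V\<^sub>s\<^sup>b\<close> are lower semicontinuous in \<open>s\<close>.\<close>

lemma continuous_on_total_variation:
  fixes \<eta> :: "real \<Rightarrow> 'v::real_normed_vector"
  assumes cont: "continuous_on {a..b} \<eta>" and fin: "total_variation a b \<eta> < \<infinity>"
  shows "continuous_on {a..b} (\<lambda>s. enn2real (total_variation a s \<eta>))"
  unfolding continuous_on_def
proof
  fix s assume s: "s \<in> {a..b}"
  let ?F = "at s within {a..b}"
  let ?v = "\<lambda>u. enn2real (total_variation a u \<eta>)" and ?w = "\<lambda>u. enn2real (total_variation u b \<eta>)"
  have fin1: "total_variation a u \<eta> < \<infinity>" "total_variation u b \<eta> < \<infinity>" if "u \<in> {a..b}" for u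
    using total_variation_mono[of a a u b \<eta>] total_variation_mono[of a u b b \<eta>] that fin
    by (auto intro: le_less_trans)
  have sum: "?v b = ?v u + ?w u" if "u \<in> {a..b}" for u
    using total_variation_add[of a u b \<eta>, symmetric] that fin1[OF that] by (simp add: enn2real_plus)
  have inF: "\<forall>\<^sub>F u in ?F. u \<in> {a..b}" by (simp add: eventually_at_filter)
  show "(?v \<longlongrightarrow> ?v s) ?F"
  proof (rule order_tendstoI)
    fix c assume "c < ?v s"
    then show "\<forall>\<^sub>F u in ?F. c < ?v u"
      by (intro eventually_less_enn2real[where f="\<lambda>u. total_variation a u \<eta>" and s=s]
            total_variation_lsc_right_endpoint[OF cont s] fin1(1)[OF s] eventually_mono[OF inF fin1(1)])
  next
    fix c assume "?v s < c"
    then have "?v b - c < ?w s" using sum[OF s] by simp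
    then have "\<forall>\<^sub>F u in ?F. ?v b - c < ?w u"
      by (intro eventually_less_enn2real[where f="\<lambda>u. total_variation u b \<eta>" and s=s]
            total_variation_lsc_left_endpoint[OF cont s] fin1(2)[OF s] eventually_mono[OF inF fin1(2)])
    with inF show "\<forall>\<^sub>F u in ?F. ?v u < c"
      by eventually_elim (use sum in fastforce)
  qed
qed

section \<open>Stieltjes integrals against continuous paths of bounded variation\<close>

text \<open>The difference of the two integrals is the integral over \<open>{a<..b}\<close>, an
  interval of mass \<open>F b - F a\<close>, on which \<open>x\<close> is compared with the constant
  \<open>c\<close>.\<close>

lemma interval_measure_integral_increment:
  fixes F x :: "real \<Rightarrow> real"
  assumes mono: "\<And>s u. s \<le> u \<Longrightarrow> F s \<le> F u" and contF: "continuous_on UNIV F"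
    and x: "continuous_on {0..T} x" and ab: "0 \<le> a" "a \<le> b" "b \<le> T"
    and close: "\<And>s. a < s \<Longrightarrow> s \<le> b \<Longrightarrow> \<bar>x s - c\<bar> \<le> e"
  shows "\<bar>(LINT s:{0..b}|interval_measure F. x s) - (LINT s:{0..a}|interval_measure F. x s)
    - c * (F b - F a)\<bar> \<le> e * (F b - F a)"
proof -
  let ?M = "interval_measure F"
  have rc: "continuous (at_right u) F" for u
    by (rule continuous_on_imp_continuous_within[OF contF]) auto
  have emI: "emeasure ?M {a<..b} = F b - F a"
    using emeasure_interval_measure_Ioc[OF ab(2) mono rc] by simp
  have em0: "emeasure ?M {0..b} = F b - F 0"
    using emeasure_interval_measure_Icc[of 0 b F] ab mono contF by auto
  have const: "set_integrable ?M {0..b} (\<lambda>_. B)" for B :: real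
    unfolding set_integrable_def using em0 by (intro integrable_scaleR_left integrable_real_indicator) auto
  have xb: "continuous_on {0..b} x" using x by (rule continuous_on_subset) (use ab in auto)
  then have "bounded (x ` {0..b})"
    using compact_continuous_image compact_imp_bounded by blast
  then obtain B where B: "\<And>s. s \<in> {0..b} \<Longrightarrow> \<bar>x s\<bar> \<le> B" unfolding bounded_iff real_norm_def by blast
  have meas: "set_borel_measurable ?M {0..b} x"
    using borel_measurable_continuous_on_indicator[OF _ xb] unfolding set_borel_measurable_def
    by (simp add: measurable_cong_sets[OF sets_interval_measure refl])
  have int: "set_integrable ?M {0..b} x"
    by (rule set_integrable_bound[OF const[of B] meas]) (use B in force)
  have intc: "set_integrable ?M {a<..b} (\<lambda>_. B)" for B :: real
    by (rule set_integrable_subset[OF const]) (use ab in auto)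
  have intI: "set_integrable ?M {a<..b} x" and int0: "set_integrable ?M {0..a} x"
    by (rule set_integrable_subset[OF int]; use ab in auto)+
  have "{0..b} = {0..a} \<union> {a<..b}" using ab by auto
  then have split: "(LINT s:{0..b}|?M. x s) - (LINT s:{0..a}|?M. x s) = (LINT s:{a<..b}|?M. x s)"
    by (subst \<open>{0..b} = _\<close>, subst set_integral_Un[OF _ int0 intI]) (auto simp del: ivl_disj_un)
  have cst: "(LINT s:{a<..b}|?M. B) = B * (F b - F a)" for B :: real
    using measure_interval_measure_Ioc[OF ab(2) mono rc] emI
    by (simp add: set_lebesgue_integral_def)
  have "(LINT s:{a<..b}|?M. x s) - c * (F b - F a) = (LINT s:{a<..b}|?M. x s - c)"
    using set_integral_diff(2)[OF intI intc] cst by simp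
  also have "\<bar>\<dots>\<bar> \<le> (LINT s:{a<..b}|?M. \<bar>x s - c\<bar>)"
    using set_integral_norm_bound[OF set_integral_diff(1)[OF intI intc[of c]]] by simp
  also have "\<dots> \<le> (LINT s:{a<..b}|?M. e)"
    using set_integrable_abs[OF set_integral_diff(1)[OF intI intc[of c]]] close
    by (intro set_integral_mono intc) auto
  finally show ?thesis using cst split by simp
qed

text \<open>Continuity of \<open>F\<close> excludes an atom at \<open>0\<close>.\<close>

lemma interval_measure_integral_at_0:
  fixes F x :: "real \<Rightarrow> real"
  assumes mono: "\<And>s u. s \<le> u \<Longrightarrow> F s \<le> F u" and contF: "continuous_on UNIV F"
  shows "(LINT s:{0..0}|interval_measure F. x s) = 0"
proof -
  have "measure (interval_measure F) {0} = 0"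
    using emeasure_interval_measure_Icc[of 0 0 F] mono contF by (simp add: measure_def)
  moreover have "(LINT s:{0..0}|interval_measure F. x s) = (LINT s:{0..0}|interval_measure F. x 0)"
    by (rule set_lebesgue_integral_cong) auto
  ultimately show ?thesis by (simp add: set_lebesgue_integral_def)
qed

lemma clamp_real: "0 \<le> T \<Longrightarrow> clamp 0 T (s::real) = max 0 (min T s)"
  unfolding clamp_def Basis_real_def by auto

locale continuous_BV_path =
  fixes T :: real and \<eta> :: "real \<Rightarrow> real"
  assumes T_pos: "0 < T" and cont: "continuous_on {0..T} \<eta>" and BV: "total_variation 0 T \<eta> < \<infinity>"
begin

text \<open>\<open>V\<close> and \<open>N\<close> are the two nondecreasing parts of the Jordan
  decomposition: \<open>\<eta> = V - N\<close> on \<open>[0,T]\<close>. They are the two integrators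
  in \<open>stieltjes_integral\<close>.\<close>

abbreviation "V \<equiv> variation_fun T \<eta>"
abbreviation "N \<equiv> \<lambda>s. variation_fun T \<eta> s - \<eta> (clamp 0 T s)"

lemma V_eq: "s \<in> {0..T} \<Longrightarrow> V s = enn2real (total_variation 0 s \<eta>)"
  by (simp add: variation_fun_def)

lemma V_cont: "continuous_on UNIV V"
  unfolding variation_fun_def using continuous_on_total_variation[OF cont BV]
  by (intro clamp_continuous_on) simp

lemma N_cont: "continuous_on UNIV N"
  using cont by (intro continuous_on_diff V_cont clamp_continuous_on) simp

text \<open>By additivity, the increment of \<open>V\<close> is the variation of
  \<open>\<eta>\<close> between the two clamped points. The bound makes both \<open>V\<close> and
  \<open>N\<close> nondecreasing and limits the increments of \<open>N\<close> to twice those of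
  \<open>V\<close>.\<close>

lemma V_diff:
  assumes "s \<le> u"
  shows "\<bar>\<eta> (clamp 0 T u) - \<eta> (clamp 0 T s)\<bar> \<le> V u - V s"
proof -
  define p q where "p = clamp 0 T s" and "q = clamp 0 T u"
  have pq: "0 \<le> p" "p \<le> q" "q \<le> T" using assms T_pos by (auto simp: p_def q_def clamp_real)
  have fin: "total_variation 0 p \<eta> < \<infinity>" "total_variation p q \<eta> < \<infinity>"
    using total_variation_mono[of 0 0 p T \<eta>] total_variation_mono[of 0 p q T \<eta>] pq BV
    by (auto intro: le_less_trans)
  have "V u = V s + enn2real (total_variation p q \<eta>)"
    unfolding variation_fun_def p_def[symmetric] q_def[symmetric]
    using total_variation_add[of 0 p q \<eta>, symmetric] pq fin by (simp add: enn2real_plus)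
  moreover have "\<bar>\<eta> q - \<eta> p\<bar> \<le> enn2real (total_variation p q \<eta>)"
    using norm_diff_le_total_variation[of p q \<eta>] pq fin
    by (metis abs_ge_zero enn2real_ennreal enn2real_mono infinity_ennreal_def real_norm_def)
  ultimately show ?thesis by (simp add: p_def q_def)
qed

lemma V_mono: "s \<le> u \<Longrightarrow> V s \<le> V u"
  using V_diff[of s u] by linarith

lemma N_mono: "s \<le> u \<Longrightarrow> N s \<le> N u"
  using V_diff[of s u] by linarith

lemma V_nonneg: "0 \<le> V s"
  by (simp add: variation_fun_def)

lemma stieltjes_integral_0: "stieltjes_integral T x \<eta> 0 = 0"
  unfolding stieltjes_integral_def
  by (simp only: interval_measure_integral_at_0[OF V_mono V_cont]
      interval_measure_integral_at_0[OF N_mono N_cont])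

lemma stieltjes_integral_increment:
  assumes x: "continuous_on {0..T} x" and ab: "0 \<le> a" "a \<le> b" "b \<le> T"
    and close: "\<And>s. a < s \<Longrightarrow> s \<le> b \<Longrightarrow> \<bar>x s - c\<bar> \<le> e" and e: "0 \<le> e"
  shows "\<bar>stieltjes_integral T x \<eta> b - stieltjes_integral T x \<eta> a - c * (\<eta> b - \<eta> a)\<bar>
    \<le> 3 * e * (V b - V a)"
proof -
  note incr = interval_measure_integral_increment[OF _ _ x ab close]
  let ?I = "\<lambda>F t. LINT s:{0..t}|interval_measure F. x s"
  have 1: "\<bar>?I V b - ?I V a - c * (V b - V a)\<bar> \<le> e * (V b - V a)"
    by (rule incr[OF V_mono V_cont])
  have 2: "\<bar>?I N b - ?I N a - c * (N b - N a)\<bar> \<le> e * (N b - N a)"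
    by (rule incr[OF N_mono N_cont])
  have \<eta>: "\<eta> (clamp 0 T a) = \<eta> a" "\<eta> (clamp 0 T b) = \<eta> b" using ab by (auto simp: clamp_real)
  \<comment> \<open>Source of the factor 3: one share of the error from \<open>V\<close> and at most
    two from \<open>N\<close>.\<close>
  have "e * (N b - N a) \<le> e * (2 * (V b - V a))"
    using V_diff[OF ab(2)] by (intro mult_left_mono e) (simp add: abs_le_iff)
  moreover have "stieltjes_integral T x \<eta> b - stieltjes_integral T x \<eta> a - c * (\<eta> b - \<eta> a) =
    (?I V b - ?I V a - c * (V b - V a)) - (?I N b - ?I N a - c * (N b - N a))"
    unfolding stieltjes_integral_def \<eta> by (simp add: algebra_simps)
  ultimately show ?thesis using 1 2 by (simp add: algebra_simps)
qed

text \<open>With \<open>c = 0\<close> and \<open>e\<close> a bound \<open>B\<close> of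
  \<open>x\<close>, the increment estimate bounds increments of the integral by \<open>3 * B\<close>
  times those of the continuous function \<open>V\<close>.\<close>

lemma stieltjes_integral_continuous:
  assumes x: "continuous_on {0..T} x"
  shows "continuous_on {0..T} (stieltjes_integral T x \<eta>)"
  unfolding continuous_on_def
proof
  fix s assume s: "s \<in> {0..T}"
  let ?F = "at s within {0..T}" and ?J = "stieltjes_integral T x \<eta>"
  have "bounded (x ` {0..T})"
    using x compact_continuous_image compact_imp_bounded by blast
  then obtain B where B: "\<And>s. s \<in> {0..T} \<Longrightarrow> \<bar>x s\<bar> \<le> B" unfolding bounded_iff real_norm_def by blast
  then have "0 \<le> B" using s abs_ge_zero order_trans by blast
  have bound: "\<bar>?J u - ?J s\<bar> \<le> 3 * B * \<bar>V u - V s\<bar>" if u: "u \<in> {0..T}" for u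
  proof (cases "s \<le> u")
    case True
    then show ?thesis
      using stieltjes_integral_increment[OF x, of s u 0 B] s u B \<open>0 \<le> B\<close> V_mono[OF True] by auto
  next
    case False
    then show ?thesis
      using stieltjes_integral_increment[OF x, of u s 0 B] s u B \<open>0 \<le> B\<close> V_mono[of u s]
      by (auto simp: abs_minus_commute)
  qed
  have "continuous_on {0..T} V" using V_cont continuous_on_subset by blast
  then have "(V \<longlongrightarrow> V s) ?F" using s by (auto simp: continuous_on_def)
  then have "((\<lambda>u. 3 * B * \<bar>V u - V s\<bar>) \<longlongrightarrow> 3 * B * \<bar>V s - V s\<bar>) ?F"
    by (intro tendsto_intros)
  then have lim: "((\<lambda>u. 3 * B * \<bar>V u - V s\<bar>) \<longlongrightarrow> 0) ?F" by simp
  have "((\<lambda>u. ?J u - ?J s) \<longlongrightarrow> 0) ?F"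
    by (rule Lim_null_comparison[OF _ lim]) (use bound in \<open>auto simp: eventually_at_filter\<close>)
  then show "(?J \<longlongrightarrow> ?J s) ?F" by (simp add: LIM_zero_iff)
qed

section \<open>Approximation by step functions and joint continuity\<close>

text \<open>The increment estimate is summed over the cells of a grid truncated at \<open>t\<close>.
  The errors telescope to a multiple of the variation, so the bound does not depend on
  \<open>t\<close>.\<close>

lemma stieltjes_integral_step_approx:
  assumes x: "continuous_on {0..T} x" and e: "0 \<le> e" and t: "t \<in> {0..T}"
    and g: "\<And>j. j < m \<Longrightarrow> g j \<le> g (Suc j)" "g 0 = 0" "g m = T"
    and close: "\<And>j s. j < m \<Longrightarrow> g j \<le> s \<Longrightarrow> s \<le> g (Suc j) \<Longrightarrow> \<bar>x s - y j\<bar> \<le> e"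
  shows "\<bar>stieltjes_integral T x \<eta> t - (\<Sum>j<m. y j * (\<eta> (min (g (Suc j)) t) - \<eta> (min (g j) t)))\<bar>
    \<le> 3 * e * enn2real (total_variation 0 T \<eta>)"
proof -
  let ?J = "stieltjes_integral T x \<eta>" and ?h = "\<lambda>j. min (g j) t"
  \<comment> \<open>The truncated grid runs from \<open>0\<close> to \<open>t\<close>, and the
    integral vanishes at \<open>0\<close>.\<close>
  have "?J t = (\<Sum>j<m. ?J (?h (Suc j)) - ?J (?h j))"
    using t g by (subst sum_lessThan_telescope) (simp add: stieltjes_integral_0)
  then have "\<bar>?J t - (\<Sum>j<m. y j * (\<eta> (?h (Suc j)) - \<eta> (?h j)))\<bar> =
    \<bar>\<Sum>j<m. ?J (?h (Suc j)) - ?J (?h j) - y j * (\<eta> (?h (Suc j)) - \<eta> (?h j))\<bar>"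
    by (simp add: sum_subtractf)
  also have "\<dots> \<le> (\<Sum>j<m. \<bar>?J (?h (Suc j)) - ?J (?h j) - y j * (\<eta> (?h (Suc j)) - \<eta> (?h j))\<bar>)"
    by (rule sum_abs)
  also have "\<dots> \<le> (\<Sum>j<m. 3 * e * (V (?h (Suc j)) - V (?h j)))"
  proof (rule sum_mono, rule stieltjes_integral_increment[OF x _ _ _ _ e])
    fix j assume j: "j \<in> {..<m}"
    then show "0 \<le> ?h j" using monotone_steps_bounds[of m g j] g t by auto
    show "?h j \<le> ?h (Suc j)" using g(1)[of j] j by auto
    show "?h (Suc j) \<le> T" using t by auto
    \<comment> \<open>If \<open>g j\<close> is at least \<open>t\<close>, both truncated ends equal
      \<open>t\<close> and no such \<open>s\<close> exists; otherwise \<open>s\<close> lies in the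
      cell from \<open>g j\<close> to \<open>g (Suc j)\<close>.\<close>
    show "\<bar>x s - y j\<bar> \<le> e" if "?h j < s" "s \<le> ?h (Suc j)" for s
      using that j by (intro close) (auto simp: min_def split: if_splits)
  qed
  also have "\<dots> = 3 * e * (V t - V 0)"
    using t g by (simp add: sum_distrib_left[symmetric] sum_lessThan_telescope[of "\<lambda>j. V (?h j)"])
  also have "\<dots> \<le> 3 * e * V T"
    using V_mono[of t T] V_nonneg[of 0] t e by (intro mult_left_mono) auto
  also have "V T = enn2real (total_variation 0 T \<eta>)" using T_pos by (intro V_eq) simp
  finally show ?thesis .
qed

end

text \<open>Uniform continuity on the compact interval, with an equidistant grid of mesh
  \<open>T / m < d\<close>.\<close>

lemma uniform_gridE:
  fixes x :: "real \<Rightarrow> real"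
  assumes T: "0 < T" and x: "continuous_on {0..T} x" and e: "0 < e"
  obtains m g where "\<And>j. j < m \<Longrightarrow> g j \<le> g (Suc j)" "g 0 = 0" "g m = T"
    "\<And>j s. j < m \<Longrightarrow> g j \<le> s \<Longrightarrow> s \<le> g (Suc j) \<Longrightarrow> \<bar>x s - x (g j)\<bar> \<le> e"
proof -
  have "uniformly_continuous_on {0..T} x" using x compact_uniformly_continuous by blast
  then obtain d where d: "0 < d"
    "\<And>s u. s \<in> {0..T} \<Longrightarrow> u \<in> {0..T} \<Longrightarrow> dist u s < d \<Longrightarrow> dist (x u) (x s) < e"
    using e unfolding uniformly_continuous_on_def by metis
  obtain m :: nat where m: "T / d < real m" using reals_Archimedean2 by blast
  have "0 < T / d" using T d(1) by simp
  then have m0: "0 < real m" using m by linarith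
  have small: "T / m < d" using m m0 d(1) by (simp add: field_simps)
  define g where "g j = real j * T / real m" for j
  have step: "g (Suc j) = g j + T / m" for j by (simp add: g_def add_divide_distrib distrib_right)
  have le: "g j \<le> g (Suc j)" for j using step T m0 by simp
  have ends: "g 0 = 0" "g m = T" using m0 by (auto simp: g_def)
  show thesis
  proof (rule that[OF le ends])
    fix j s assume j: "j < m" and s: "g j \<le> s" "s \<le> g (Suc j)"
    have "0 \<le> g j" "g (Suc j) \<le> T"
      using monotone_steps_bounds[of m g j] monotone_steps_bounds[of m g "Suc j"] le ends j by auto
    then show "\<bar>x s - x (g j)\<bar> \<le> e"
      using d(2)[of "g j" s] s small step by (auto simp: dist_real_def)
  qed
qed

text \<open>Both integrals are compared with sums over one grid that is adapted to \<open>x\<close>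
  only. The variation bound \<open>K\<close> controls the approximation errors for
  \<open>\<eta>\<close> and \<open>\<eta>'\<close> alike, and the resulting \<open>d\<close> serves
  all \<open>t\<close> at once.\<close>

lemma stieltjes_integral_joint_continuity:
  assumes T: "0 < T" and x: "continuous_on {0..T} x" and \<eta>: "continuous_on {0..T} \<eta>"
    and K: "total_variation 0 T \<eta> \<le> ennreal K" "0 \<le> K" and e: "0 < e"
  obtains d where "0 < d"
    "\<And>x' \<eta>' t. continuous_on {0..T} x' \<Longrightarrow> continuous_on {0..T} \<eta>' \<Longrightarrow>
      total_variation 0 T \<eta>' \<le> ennreal K \<Longrightarrow>
      (\<And>s. s \<in> {0..T} \<Longrightarrow> \<bar>x' s - x s\<bar> \<le> d) \<Longrightarrow> (\<And>s. s \<in> {0..T} \<Longrightarrow> \<bar>\<eta>' s - \<eta> s\<bar> \<le> d) \<Longrightarrow>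
      t \<in> {0..T} \<Longrightarrow> \<bar>stieltjes_integral T x' \<eta>' t - stieltjes_integral T x \<eta> t\<bar> \<le> e"
proof -
  \<comment> \<open>The step errors are \<open>3 * e1 * K\<close> for \<open>x\<close> and
    \<open>6 * e1 * K\<close> for \<open>x'\<close>; together they may use up
    \<open>e / 2\<close>.\<close>
  define e1 where "e1 = e / (18 * (K + 1))"
  have e1: "0 < e1" using e K(2) by (simp add: e1_def)
  have e1K: "9 * e1 * K \<le> e / 2" using e K(2) by (simp add: e1_def field_simps)
  obtain m g where g: "\<And>j. j < m \<Longrightarrow> g j \<le> g (Suc j)" "g 0 = 0" "g m = T"
    and gx: "\<And>j s. j < m \<Longrightarrow> g j \<le> s \<Longrightarrow> s \<le> g (Suc j) \<Longrightarrow> \<bar>x s - x (g j)\<bar> \<le> e1"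
    using uniform_gridE[OF T x e1] by metis
  define C where "C = (\<Sum>j<m. \<bar>x (g j)\<bar>)"
  have C: "0 \<le> C" by (simp add: C_def sum_nonneg)
  \<comment> \<open>The first bound keeps \<open>x'\<close> within \<open>2 * e1\<close> of
    \<open>x (g j)\<close> on each cell. The second makes the change \<open>2 * d * C\<close> of the
    step sum at most \<open>e / 2\<close>.\<close>
  define d where "d = min e1 (e / (4 * (C + 1)))"
  have d: "0 < d" "d \<le> e1" using e1 e C by (auto simp: d_def)
  have "d * (4 * (C + 1)) \<le> e"
    using C by (simp add: d_def min_le_iff_disj pos_le_divide_eq[symmetric])
  then have dC: "2 * d * C \<le> e / 2" using d(1) by (simp add: algebra_simps)
  show thesis
  proof (rule that[OF d(1)])
    fix x' \<eta>' t
    assume x': "continuous_on {0..T} x'" and \<eta>': "continuous_on {0..T} \<eta>'"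
      and K': "total_variation 0 T \<eta>' \<le> ennreal K"
      and dx: "\<And>s. s \<in> {0..T} \<Longrightarrow> \<bar>x' s - x s\<bar> \<le> d"
      and d\<eta>: "\<And>s. s \<in> {0..T} \<Longrightarrow> \<bar>\<eta>' s - \<eta> s\<bar> \<le> d"
      and t: "t \<in> {0..T}"
    interpret p: continuous_BV_path T \<eta>
      by unfold_locales (use T \<eta> le_less_trans[OF K(1)] in auto)
    interpret p': continuous_BV_path T \<eta>'
      by unfold_locales (use T \<eta>' le_less_trans[OF K'] in auto)
    \<comment> \<open>The coefficients \<open>x (g j)\<close> are used for \<open>\<eta>'\<close>
      too, so that \<open>S \<eta>' - S \<eta>\<close> involves only the uniform distance of the
      integrators.\<close>
    define S where "S z = (\<Sum>j<m. x (g j) * (z (min (g (Suc j)) t) - z (min (g j) t)))" for z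
    have g_in: "g j \<in> {0..T}" if "j \<le> m" for j
      using monotone_steps_bounds[of m g j] that g by auto
    have bd: "enn2real (total_variation 0 T z) \<le> K" if "total_variation 0 T z \<le> ennreal K"
      for z :: "real \<Rightarrow> real"
      using enn2real_mono[OF that] K(2) by simp
    have "\<bar>stieltjes_integral T x \<eta> t - S \<eta>\<bar> \<le> 3 * e1 * enn2real (total_variation 0 T \<eta>)"
      unfolding S_def by (rule p.stieltjes_integral_step_approx[OF x _ t g gx]) (use e1 in auto)
    also have "\<dots> \<le> 3 * e1 * K" using bd[OF K(1)] e1 by simp
    finally have 1: "\<bar>stieltjes_integral T x \<eta> t - S \<eta>\<bar> \<le> 3 * e1 * K" .
    have "\<bar>stieltjes_integral T x' \<eta>' t - S \<eta>'\<bar> \<le> 3 * (2 * e1) * enn2real (total_variation 0 T \<eta>')"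
      unfolding S_def
    proof (rule p'.stieltjes_integral_step_approx[OF x' _ t g])
      fix j s assume j: "j < m" and s: "g j \<le> s" "s \<le> g (Suc j)"
      have "s \<in> {0..T}" using g_in[of j] g_in[of "Suc j"] j s by auto
      then show "\<bar>x' s - x (g j)\<bar> \<le> 2 * e1" using dx[of s] gx[OF j s] d(2) by linarith
    qed (use e1 in auto)
    also have "\<dots> \<le> 3 * (2 * e1) * K" using bd[OF K'] e1 by simp
    finally have 2: "\<bar>stieltjes_integral T x' \<eta>' t - S \<eta>'\<bar> \<le> 6 * e1 * K" by simp
    have "\<bar>S \<eta>' - S \<eta>\<bar> \<le> (\<Sum>j<m. \<bar>x (g j)\<bar> * (2 * d))"
    proof -
      have "S \<eta>' - S \<eta> = (\<Sum>j<m. x (g j) * ((\<eta>' (min (g (Suc j)) t) - \<eta> (min (g (Suc j)) t))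
          - (\<eta>' (min (g j) t) - \<eta> (min (g j) t))))"
        unfolding S_def by (simp add: sum_subtractf[symmetric] algebra_simps)
      also have "\<bar>\<dots>\<bar> \<le> (\<Sum>j<m. \<bar>x (g j)\<bar> * (2 * d))"
      proof (rule order_trans[OF sum_abs], rule sum_mono, unfold abs_mult, rule mult_left_mono)
        fix j assume "j \<in> {..<m}"
        then have "min (g j) t \<in> {0..T}" "min (g (Suc j)) t \<in> {0..T}"
          using g_in[of j] g_in[of "Suc j"] t by auto
        from d\<eta>[OF this(1)] d\<eta>[OF this(2)]
        show "\<bar>\<eta>' (min (g (Suc j)) t) - \<eta> (min (g (Suc j)) t)
          - (\<eta>' (min (g j) t) - \<eta> (min (g j) t))\<bar> \<le> 2 * d" by linarith
      qed simp
      finally show ?thesis .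
    qed
    then have 3: "\<bar>S \<eta>' - S \<eta>\<bar> \<le> 2 * d * C"
      by (simp add: C_def sum_distrib_right[symmetric] mult.commute)
    show "\<bar>stieltjes_integral T x' \<eta>' t - stieltjes_integral T x \<eta> t\<bar> \<le> e"
      using 1 2 3 e1K dC by linarith
  qed
qed

section \<open>Mappings continuous on a closed exhaustion\<close>

lemma openin_subset_Pow: "{U. openin S U} \<subseteq> Pow (topspace S)"
  using openin_subset by auto

lemma space_borel_of_top [simp]: "space (borel_of_top S) = topspace S"
  unfolding borel_of_top_def by (rule space_measure_of[OF openin_subset_Pow])

lemma openin_in_sets_borel_of_top: "openin S U \<Longrightarrow> U \<in> sets (borel_of_top S)"
  unfolding borel_of_top_def by (simp add: sets_measure_of[OF openin_subset_Pow] sigma_sets.Basic)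

lemma closedin_in_sets_borel_of_top:
  assumes "closedin S A"
  shows "A \<in> sets (borel_of_top S)"
proof -
  have "space (borel_of_top S) - (topspace S - A) \<in> sets (borel_of_top S)"
    using assms by (intro sets.compl_sets openin_in_sets_borel_of_top) (simp add: closedin_def)
  then show ?thesis
    using closedin_subset[OF assms] by (simp add: Diff_Diff_Int inf.absorb2)
qed

lemma measurable_borel_of_topI:
  assumes "\<And>z. z \<in> space M \<Longrightarrow> f z \<in> topspace S"
    and "\<And>U. openin S U \<Longrightarrow> f -` U \<inter> space M \<in> sets M"
  shows "f \<in> measurable M (borel_of_top S)"
  unfolding borel_of_top_def
  by (rule measurable_measure_of[OF openin_subset_Pow]) (use assms in auto)

lemma borel_measurable_continuous_map:
  fixes f :: "'s \<Rightarrow> 'v::topological_space"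
  assumes "continuous_map S euclidean f"
  shows "f \<in> borel_measurable (borel_of_top S)"
proof (rule borel_measurableI)
  fix U :: "'v set" assume "open U"
  then have "openin S {z \<in> topspace S. f z \<in> U}"
    using openin_continuous_map_preimage[OF assms, of U] by simp
  moreover have "f -` U \<inter> space (borel_of_top S) = {z \<in> topspace S. f z \<in> U}" by auto
  ultimately show "f -` U \<inter> space (borel_of_top S) \<in> sets (borel_of_top S)"
    by (simp add: openin_in_sets_borel_of_top)
qed

text \<open>Within each closed \<open>A k\<close> the preimage of an open set is relatively open,
  hence Borel. Countably many such pieces are joined, and outside all \<open>A k\<close> the
  constant value adds either everything or nothing.\<close>

lemma measurable_piecewise_continuous_map:
  fixes A :: "nat \<Rightarrow> 's set"
  assumes closed: "\<And>k. closedin S (A k)"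
    and cont: "\<And>k. continuous_map (subtopology S (A k)) S' \<Phi>"
    and const: "\<And>z. z \<in> topspace S \<Longrightarrow> z \<notin> (\<Union>k. A k) \<Longrightarrow> \<Phi> z = y" and y: "y \<in> topspace S'"
  shows "\<Phi> \<in> measurable (borel_of_top S) (borel_of_top S')"
proof (rule measurable_borel_of_topI)
  fix z assume z: "z \<in> space (borel_of_top S)"
  show "\<Phi> z \<in> topspace S'"
  proof (cases "\<exists>k. z \<in> A k")
    case True
    then obtain k where "z \<in> A k" by blast
    then show ?thesis
      using continuous_map_image_subset_topspace[OF cont[of k]] z by (auto simp: image_subset_iff)
  next
    case False
    then show ?thesis using const[of z] z y by simp
  qed
next
  have A_sub: "A k \<subseteq> topspace S" for k using closed closedin_subset by blast
  have A_sets: "A k \<in> sets (borel_of_top S)" for k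
    using closed by (rule closedin_in_sets_borel_of_top)
  fix U assume U: "openin S' U"
  have piece: "\<Phi> -` U \<inter> A k \<in> sets (borel_of_top S)" for k
  proof -
    have "openin (subtopology S (A k)) {z \<in> topspace (subtopology S (A k)). \<Phi> z \<in> U}"
      by (rule openin_continuous_map_preimage[OF cont U])
    then obtain W where W: "openin S W"
      "{z \<in> topspace (subtopology S (A k)). \<Phi> z \<in> U} = W \<inter> A k"
      unfolding openin_subtopology by blast
    have "\<Phi> -` U \<inter> A k = W \<inter> A k"
      unfolding W(2)[symmetric] using A_sub by auto
    then show ?thesis
      using openin_in_sets_borel_of_top[OF W(1)] A_sets by auto
  qed
  have unions: "(\<Union>k. \<Phi> -` U \<inter> A k) \<in> sets (borel_of_top S)" "(\<Union>k. A k) \<in> sets (borel_of_top S)"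
    by (rule sets.countable_UN; use piece A_sets in blast)+
  have "\<Phi> -` U \<inter> space (borel_of_top S) =
    (\<Union>k. \<Phi> -` U \<inter> A k) \<union> (if y \<in> U then space (borel_of_top S) - (\<Union>k. A k) else {})"
    using A_sub const by (cases "y \<in> U") (auto, metis)
  also have "\<dots> \<in> sets (borel_of_top S)"
    by (cases "y \<in> U") (simp_all only: if_True if_False Un_empty_right sets.Un sets.Diff sets.top unions)
  finally show "\<Phi> -` U \<inter> space (borel_of_top S) \<in> sets (borel_of_top S)" .
qed

section \<open>Weak limits and a continuous mapping principle\<close>

text \<open>The open-set half of the portmanteau theorem. In a metrizable space the complement of
  \<open>A\<close> is an increasing union of closed sets \<open>C m\<close>. A Urysohn function that
  is \<open>0\<close> on \<open>A\<close> and \<open>1\<close> on \<open>C m\<close> is a test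
  function lying between the indicators of \<open>C m\<close> and of the complement of
  \<open>A\<close>; continuity from below then gives the bound for the whole complement.\<close>

lemma limit_law_closed_complement_bound:
  fixes e :: real
  assumes metrizable: "metrizable_space S"
    and P: "\<And>n. n \<ge> 1 \<Longrightarrow> prob_space (P n)" and Q: "prob_space Q"
    and Z: "\<And>n. n \<ge> 1 \<Longrightarrow> Z n \<in> measurable (P n) (borel_of_top S)"
    and Y: "Y \<in> measurable Q (borel_of_top S)"
    and conv: "converges_in_distribution S P Z Q Y"
    and A: "closedin S A"
    and le: "\<And>n. n \<ge> 1 \<Longrightarrow> measure (P n) {\<omega> \<in> space (P n). Z n \<omega> \<notin> A} \<le> e"
  shows "measure Q {\<omega> \<in> space Q. Y \<omega> \<notin> A} \<le> e"
proof -
  interpret Q: prob_space Q by (rule Q)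
  have "openin S (topspace S - A)" using A by blast
  then have "fsigma_in S (topspace S - A)" by (rule open_imp_fsigma_in[OF metrizable])
  then obtain C where C: "\<And>m. closedin S (C m)" "\<And>m. C m \<subseteq> C (Suc m)"
    "\<Union> (range C) = topspace S - A"
    unfolding fsigma_in_ascending by metis
  have meas: "{\<omega> \<in> space M. W \<omega> \<in> B} \<in> sets M"
    if "W \<in> measurable M (borel_of_top S)" "B \<in> sets (borel_of_top S)" for M W B
    using measurable_sets[OF that] by (simp add: vimage_def Int_def conj_commute)
  have inS: "W \<omega> \<in> topspace S"
    if "W \<in> measurable M (borel_of_top S)" "\<omega> \<in> space M" for M W \<omega>
    using measurable_space[OF that] by simp
  have Ac: "topspace S - A \<in> sets (borel_of_top S)"
    using A by (intro openin_in_sets_borel_of_top) blast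
  have piece: "measure Q {\<omega> \<in> space Q. Y \<omega> \<in> C m} \<le> e" for m
  proof -
    have "disjnt A (C m)" using C(3) by (auto simp: disjnt_iff)
    then obtain f :: "_ \<Rightarrow> real" where f: "continuous_map S (top_of_set {0..1}) f"
      and fA: "f ` A \<subseteq> {0}" and fC: "f ` C m \<subseteq> {1}"
      using Urysohn_lemma[OF metrizable_imp_normal_space[OF metrizable] A C(1), of m 0 1] by auto
    have fc: "continuous_map S euclideanreal f" and f01: "\<And>z. z \<in> topspace S \<Longrightarrow> f z \<in> {0..1}"
      using f by (auto simp: continuous_map_in_subtopology)
    have fm: "f \<in> borel_measurable (borel_of_top S)"
      by (rule borel_measurable_continuous_map[OF fc])
    have "bounded (f ` topspace S)"
      using f01 by (intro boundedI[of _ 1]) auto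
    then have lim: "(\<lambda>n. \<integral>\<omega>. f (Z n \<omega>) \<partial>P n) \<longlonglongrightarrow> (\<integral>\<omega>. f (Y \<omega>) \<partial>Q)"
      using conv fc unfolding converges_in_distribution_def by blast
    have int: "integrable M (\<lambda>\<omega>. f (W \<omega>))"
      if "finite_measure M" "W \<in> measurable M (borel_of_top S)" for M W
      by (rule finite_measure.integrable_const_bound[OF that(1), of _ 1])
        (use f01 inS[OF that(2)] measurable_compose[OF that(2) fm] in auto)
    have "(\<integral>\<omega>. f (Z n \<omega>) \<partial>P n) \<le> e" if n: "n \<ge> 1" for n
    proof -
      interpret prob_space "P n" by (rule P[OF n])
      have set: "{\<omega> \<in> space (P n). Z n \<omega> \<notin> A} \<in> sets (P n)"
      proof -
        have "{\<omega> \<in> space (P n). Z n \<omega> \<notin> A} = {\<omega> \<in> space (P n). Z n \<omega> \<in> topspace S - A}"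
          using inS[OF Z[OF n]] by auto
        then show ?thesis using meas[OF Z[OF n] Ac] by simp
      qed
      have "(\<integral>\<omega>. f (Z n \<omega>) \<partial>P n) \<le> (\<integral>\<omega>. indicator {\<omega> \<in> space (P n). Z n \<omega> \<notin> A} \<omega> \<partial>P n)"
      proof (rule integral_mono[OF int[OF finite_measure_axioms Z[OF n]]])
        show "integrable (P n) (indicat_real {\<omega> \<in> space (P n). Z n \<omega> \<notin> A})"
          using set by (simp add: integrable_real_indicator emeasure_eq_measure)
        show "f (Z n \<omega>) \<le> indicat_real {\<omega> \<in> space (P n). Z n \<omega> \<notin> A} \<omega>"
          if "\<omega> \<in> space (P n)" for \<omega>
          using f01[OF inS[OF Z[OF n] that]] fA that by (auto simp: indicator_def)
      qed
      also have "\<dots> \<le> e" using le[OF n] set by simp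
      finally show ?thesis .
    qed
    \<comment> \<open>The bound is known only for \<open>n \<ge> 1\<close>, which suffices in the
      limit.\<close>
    then have "(\<integral>\<omega>. f (Y \<omega>) \<partial>Q) \<le> e"
      by (intro LIMSEQ_le_const2[OF lim]) auto
    moreover have "measure Q {\<omega> \<in> space Q. Y \<omega> \<in> C m} \<le> (\<integral>\<omega>. f (Y \<omega>) \<partial>Q)"
    proof -
      have set: "{\<omega> \<in> space Q. Y \<omega> \<in> C m} \<in> sets Q"
        by (rule meas[OF Y closedin_in_sets_borel_of_top[OF C(1)]])
      have "measure Q {\<omega> \<in> space Q. Y \<omega> \<in> C m} =
        (\<integral>\<omega>. indicator {\<omega> \<in> space Q. Y \<omega> \<in> C m} \<omega> \<partial>Q)"
        using set by simp
      also have "\<dots> \<le> (\<integral>\<omega>. f (Y \<omega>) \<partial>Q)"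
      proof (rule integral_mono[OF _ int[OF Q.finite_measure_axioms Y]])
        show "integrable Q (indicat_real {\<omega> \<in> space Q. Y \<omega> \<in> C m})"
          using set by (simp add: integrable_real_indicator Q.emeasure_eq_measure)
        show "indicat_real {\<omega> \<in> space Q. Y \<omega> \<in> C m} \<omega> \<le> f (Y \<omega>)" if "\<omega> \<in> space Q" for \<omega>
          using f01[OF inS[OF Y that]] fC that by (auto simp: indicator_def)
      qed
      finally show ?thesis .
    qed
    ultimately show ?thesis by linarith
  qed
  have "(\<lambda>m. measure Q {\<omega> \<in> space Q. Y \<omega> \<in> C m}) \<longlonglongrightarrow>
    measure Q (\<Union>m. {\<omega> \<in> space Q. Y \<omega> \<in> C m})"
  proof (rule Q.finite_Lim_measure_incseq)
    show "range (\<lambda>m. {\<omega> \<in> space Q. Y \<omega> \<in> C m}) \<subseteq> sets Q"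
      using meas[OF Y closedin_in_sets_borel_of_top[OF C(1)]] by blast
    show "incseq (\<lambda>m. {\<omega> \<in> space Q. Y \<omega> \<in> C m})"
      using C(2) by (intro incseq_SucI) auto
  qed
  then have "measure Q (\<Union>m. {\<omega> \<in> space Q. Y \<omega> \<in> C m}) \<le> e"
    using piece by (intro LIMSEQ_le_const2) auto
  moreover have "(\<Union>m. {\<omega> \<in> space Q. Y \<omega> \<in> C m}) = {\<omega> \<in> space Q. Y \<omega> \<notin> A}"
    using C(3) inS[OF Y] by auto
  ultimately show ?thesis by simp
qed

text \<open>The difference \<open>f - g\<close> vanishes off \<open>E\<close> and is at most
  \<open>2 * B\<close> in absolute value on \<open>E\<close>.\<close>

lemma (in prob_space) expectation_diff_bound:
  fixes f g :: "'a \<Rightarrow> real"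
  assumes f: "f \<in> borel_measurable M" and g: "g \<in> borel_measurable M"
    and bf: "\<And>\<omega>. \<omega> \<in> space M \<Longrightarrow> \<bar>f \<omega>\<bar> \<le> B" and bg: "\<And>\<omega>. \<omega> \<in> space M \<Longrightarrow> \<bar>g \<omega>\<bar> \<le> B"
    and E: "E \<in> sets M" and eq: "\<And>\<omega>. \<omega> \<in> space M \<Longrightarrow> \<omega> \<notin> E \<Longrightarrow> f \<omega> = g \<omega>"
  shows "\<bar>expectation f - expectation g\<bar> \<le> 2 * B * prob E"
proof -
  have int: "integrable M f" "integrable M g"
    by (rule integrable_const_bound[of _ B]; use f g bf bg in auto)+
  have "\<bar>expectation f - expectation g\<bar> = \<bar>expectation (\<lambda>\<omega>. f \<omega> - g \<omega>)\<bar>"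
    using int by simp
  also have "\<dots> \<le> expectation (\<lambda>\<omega>. \<bar>f \<omega> - g \<omega>\<bar>)" by (rule integral_abs_bound)
  also have "\<dots> \<le> expectation (\<lambda>\<omega>. 2 * B * indicator E \<omega>)"
  proof (rule integral_mono)
    show "integrable M (\<lambda>\<omega>. \<bar>f \<omega> - g \<omega>\<bar>)" using int by simp
    show "integrable M (\<lambda>\<omega>. 2 * B * indicat_real E \<omega>)"
      using E by (intro integrable_mult_right integrable_real_indicator) (auto simp: emeasure_eq_measure)
    show "\<bar>f \<omega> - g \<omega>\<bar> \<le> 2 * B * indicat_real E \<omega>" if "\<omega> \<in> space M" for \<omega>
      using bf[OF that] bg[OF that] eq[OF that] by (cases "\<omega> \<in> E") auto
  qed
  also have "\<dots> = 2 * B * prob E" using E by simp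
  finally show ?thesis .
qed

text \<open>The usual continuous mapping theorem does not apply, as \<open>\<Phi>\<close> may be discontinuous everywhere.\<close>

lemma continuous_mapping_on_closed_exhaustion:
  fixes A :: "nat \<Rightarrow> 's set"
  assumes metrizable: "metrizable_space S"
    and P: "\<And>n. n \<ge> 1 \<Longrightarrow> prob_space (P n)" and Q: "prob_space Q"
    and Z: "\<And>n. n \<ge> 1 \<Longrightarrow> Z n \<in> measurable (P n) (borel_of_top S)"
    and Y: "Y \<in> measurable Q (borel_of_top S)"
    and conv: "converges_in_distribution S P Z Q Y"
    and A: "\<And>k. closedin S (A k)"
    and cont: "\<And>k. continuous_map (subtopology S (A k)) S' \<Phi>"
    and \<Phi>: "\<Phi> \<in> measurable (borel_of_top S) (borel_of_top S')"
    and tight: "\<And>e. e > 0 \<Longrightarrow> \<exists>k. \<forall>n\<ge>1. measure (P n) {\<omega> \<in> space (P n). Z n \<omega> \<notin> A k} \<le> e"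
  shows "converges_in_distribution S' P (\<lambda>n \<omega>. \<Phi> (Z n \<omega>)) Q (\<lambda>\<omega>. \<Phi> (Y \<omega>))"
  unfolding converges_in_distribution_def
proof (intro allI impI, elim conjE)
  fix f :: "_ \<Rightarrow> real"
  assume f: "continuous_map S' euclideanreal f" and "bounded (f ` topspace S')"
  then obtain B where "0 < B" and B: "\<And>y. y \<in> topspace S' \<Longrightarrow> \<bar>f y\<bar> \<le> B"
    unfolding bounded_pos by auto
  then have B0: "0 \<le> B" by simp
  have fm: "f \<in> borel_measurable (borel_of_top S')" by (rule borel_measurable_continuous_map[OF f])
  have \<Phi>S: "\<Phi> z \<in> topspace S'" if "z \<in> topspace S" for z
    using measurable_space[OF \<Phi>] that by simp
  show "(\<lambda>n. \<integral>\<omega>. f (\<Phi> (Z n \<omega>)) \<partial>P n) \<longlonglongrightarrow> (\<integral>\<omega>. f (\<Phi> (Y \<omega>)) \<partial>Q)"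
  proof (rule LIMSEQ_I)
    fix r :: real assume r: "0 < r"
    \<comment> \<open>Replacing \<open>f\<close> composed with \<open>\<Phi>\<close> by its
      extension costs \<open>2 * B * e\<close> under \<open>P n\<close> and again under
      \<open>Q\<close>. The total \<open>4 * B * e\<close> stays within \<open>r / 2\<close> and
      leaves \<open>r / 2\<close> for the convergence.\<close>
    define e where "e = r / (8 * (B + 1))"
    have e: "0 < e" using r B0 by (simp add: e_def)
    have Be: "4 * B * e \<le> r / 2" using r B0 by (simp add: e_def field_simps)
    obtain k where k: "\<And>n. n \<ge> 1 \<Longrightarrow> measure (P n) {\<omega> \<in> space (P n). Z n \<omega> \<notin> A k} \<le> e"
      using tight[OF e] by blast
    have kQ: "measure Q {\<omega> \<in> space Q. Y \<omega> \<notin> A k} \<le> e"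
      by (rule limit_law_closed_complement_bound[OF metrizable P Q Z Y conv A k])
    have Asub: "A k \<subseteq> topspace S" using A closedin_subset by blast
    have "(f \<circ> \<Phi>) ` A k \<subseteq> {-B..B}"
    proof (rule image_subsetI)
      fix z assume "z \<in> A k"
      then have "\<bar>f (\<Phi> z)\<bar> \<le> B" using B \<Phi>S Asub by blast
      then show "(f \<circ> \<Phi>) z \<in> {-B..B}" by (simp add: abs_le_iff)
    qed
    moreover have "continuous_map (subtopology S (A k)) euclideanreal (f \<circ> \<Phi>)"
      by (rule continuous_map_compose[OF cont f])
    \<comment> \<open>Tietze extension with values kept in \<open>[-B,B]\<close>: \<open>G\<close>
      is a legitimate test function, and it differs from the original only off
      \<open>A k\<close>.\<close>
    ultimately obtain G where G: "continuous_map S euclideanreal G"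
      "\<And>z. z \<in> A k \<Longrightarrow> G z = (f \<circ> \<Phi>) z" "G ` topspace S \<subseteq> {-B..B}"
      using Tietze_extension_closed_real_interval[OF metrizable_imp_normal_space[OF metrizable] A,
          of k "f \<circ> \<Phi>" "- B" B] B0 by auto
    have Gm: "G \<in> borel_measurable (borel_of_top S)" by (rule borel_measurable_continuous_map[OF G(1)])
    have GB: "\<bar>G z\<bar> \<le> B" if "z \<in> topspace S" for z
      using G(3) that by (auto simp: image_subset_iff abs_le_iff)
    \<comment> \<open>Stated for an arbitrary \<open>W\<close>, to be applied both to
      \<open>Z n\<close> and to the limit \<open>Y\<close>.\<close>
    have compare: "\<bar>(\<integral>\<omega>. f (\<Phi> (W \<omega>)) \<partial>M) - (\<integral>\<omega>. G (W \<omega>) \<partial>M)\<bar> \<le> 2 * B * e"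
      if M: "prob_space M" and W: "W \<in> measurable M (borel_of_top S)"
        and le: "measure M {\<omega> \<in> space M. W \<omega> \<notin> A k} \<le> e" for M W
    proof -
      interpret prob_space M by (rule M)
      have WS: "W \<omega> \<in> topspace S" if "\<omega> \<in> space M" for \<omega>
        using measurable_space[OF W that] by simp
      have "{\<omega> \<in> space M. W \<omega> \<notin> A k} = space M - (W -` A k \<inter> space M)" by auto
      also have "\<dots> \<in> sets M"
        using measurable_sets[OF W closedin_in_sets_borel_of_top[OF A]] by (rule sets.compl_sets)
      finally have E: "{\<omega> \<in> space M. W \<omega> \<notin> A k} \<in> sets M" .
      have "\<bar>(\<integral>\<omega>. f (\<Phi> (W \<omega>)) \<partial>M) - (\<integral>\<omega>. G (W \<omega>) \<partial>M)\<bar>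
        \<le> 2 * B * measure M {\<omega> \<in> space M. W \<omega> \<notin> A k}"
      proof (rule expectation_diff_bound)
        show "(\<lambda>\<omega>. G (W \<omega>)) \<in> borel_measurable M" by (rule measurable_compose[OF W Gm])
        show "(\<lambda>\<omega>. f (\<Phi> (W \<omega>))) \<in> borel_measurable M"
          by (rule measurable_compose[OF measurable_compose[OF W \<Phi>] fm])
        show "f (\<Phi> (W \<omega>)) = G (W \<omega>)"
          if "\<omega> \<in> space M" "\<omega> \<notin> {\<omega> \<in> space M. W \<omega> \<notin> A k}" for \<omega>
          using that G(2)[of "W \<omega>"] by simp
      qed (use WS \<Phi>S B GB E in blast)+
      also have "\<dots> \<le> 2 * B * e" using le B0 by (intro mult_left_mono) auto
      finally show ?thesis .
    qed
    have "bounded (G ` topspace S)" using GB by (intro boundedI[of _ B]) auto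
    then have "(\<lambda>n. \<integral>\<omega>. G (Z n \<omega>) \<partial>P n) \<longlonglongrightarrow> (\<integral>\<omega>. G (Y \<omega>) \<partial>Q)"
      using conv G(1) unfolding converges_in_distribution_def by blast
    from LIMSEQ_D[OF this, of "r / 2"] r obtain n0 where n0: "\<And>n. n \<ge> n0 \<Longrightarrow>
        \<bar>(\<integral>\<omega>. G (Z n \<omega>) \<partial>P n) - (\<integral>\<omega>. G (Y \<omega>) \<partial>Q)\<bar> < r / 2"
      unfolding real_norm_def by auto
    show "\<exists>n0. \<forall>n\<ge>n0. norm ((\<integral>\<omega>. f (\<Phi> (Z n \<omega>)) \<partial>P n) - (\<integral>\<omega>. f (\<Phi> (Y \<omega>)) \<partial>Q)) < r"
    proof (intro exI allI impI)
      fix n assume "n \<ge> max n0 1"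
      then have n: "n \<ge> n0" "n \<ge> 1" by auto
      show "norm ((\<integral>\<omega>. f (\<Phi> (Z n \<omega>)) \<partial>P n) - (\<integral>\<omega>. f (\<Phi> (Y \<omega>)) \<partial>Q)) < r"
        using compare[OF P[OF n(2)] Z[OF n(2)] k[OF n(2)]] compare[OF Q Y kQ] n0[OF n(1)] Be
        unfolding real_norm_def by linarith
    qed
  qed
qed

section \<open>The integral map on path space\<close>

lemma topspace_C_top: "topspace (C_top T) = {f. f \<in> extensional {0..T} \<and> continuous_on {0..T} f}"
  \<comment> \<open>Compactness of \<open>{0..T}\<close> makes the boundedness required by
    \<open>cfunspace\<close> automatic.\<close>
  unfolding C_top_def by (subst topspace_mtopology_of, subst compactin_mspace_cfunspace) auto

lemma continuous_on_restrict_iff: "continuous_on S (restrict f S) \<longleftrightarrow> continuous_on S f"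
  by (rule continuous_on_cong) auto

lemma metrizable_C_top: "metrizable_space (C_top T)"
  unfolding C_top_def mtopology_of_def
  by (rule Metric_space.metrizable_space_mtopology[OF Metric_space_mspace_mdist])

lemma continuous_map_eval:
  assumes s: "s \<in> {0..T}"
  shows "continuous_map (C_top T) euclidean (\<lambda>f. f s :: 'v :: metric_space)"
proof -
  let ?C = "cfunspace (top_of_set {0..T}) (euclidean_metric :: 'v metric)"
  have "Lipschitz_continuous_map ?C (euclidean_metric :: 'v metric) (\<lambda>f. f s)"
    unfolding Lipschitz_continuous_map_def
  proof (intro conjI exI[of _ 1] ballI)
    fix f g :: "real \<Rightarrow> 'v" assume "f \<in> mspace ?C" "g \<in> mspace ?C"
    then show "mdist euclidean_metric (f s) (g s) \<le> 1 * mdist ?C f g"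
      using mdist_cfunspace_imp_mdist_le[of f "top_of_set {0..T}" euclidean_metric g "mdist ?C f g" s] s
      by simp
  qed simp
  then show ?thesis
    using Lipschitz_continuous_imp_continuous_map unfolding C_top_def by fastforce
qed

lemma C_top_neighbourhood:
  fixes f :: "real \<Rightarrow> 'v :: metric_space"
  assumes f: "f \<in> topspace (C_top T)" and d: "0 < d"
  obtains U where "openin (C_top T) U" "f \<in> U" "\<And>g s. g \<in> U \<Longrightarrow> s \<in> {0..T} \<Longrightarrow> dist (g s) (f s) \<le> d"
proof -
  let ?C = "cfunspace (top_of_set {0..T}) (euclidean_metric :: 'v metric)"
  note mspace_cfunspace [simp del]
  interpret C: Metric_space "mspace ?C" "mdist ?C" by (rule Metric_space_mspace_mdist)
  have fC: "f \<in> mspace ?C" using f unfolding C_top_def by simp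
  show thesis
  proof
    show "openin (C_top T) (C.mball f d)" unfolding C_top_def mtopology_of_def by simp
    show "f \<in> C.mball f d" using fC d by simp
    fix g s assume "g \<in> C.mball f d" and s: "s \<in> {0..T}"
    then have "g \<in> mspace ?C" "mdist ?C f g \<le> d" by auto
    then show "dist (g s) (f s) \<le> d"
      using mdist_cfunspace_imp_mdist_le[OF fC, of g d s] s by (simp add: dist_commute)
  qed
qed

text \<open>Reduces continuity into path space to estimates that are uniform in time. The proof
  invokes them with \<open>e / 2\<close>, because a non-strict bound must yield membership in an
  open ball.\<close>

lemma continuous_map_into_C_top:
  fixes \<Phi> :: "'z \<Rightarrow> real \<Rightarrow> 'v :: metric_space"
  assumes T: "0 \<le> T" and mem: "\<And>z. z \<in> topspace X \<Longrightarrow> \<Phi> z \<in> topspace (C_top T)"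
    and nbhd: "\<And>z e. z \<in> topspace X \<Longrightarrow> 0 < e \<Longrightarrow>
      \<exists>U. openin X U \<and> z \<in> U \<and> (\<forall>w\<in>U. \<forall>s\<in>{0..T}. dist (\<Phi> z s) (\<Phi> w s) \<le> e)"
  shows "continuous_map X (C_top T) \<Phi>"
proof -
  let ?C = "cfunspace (top_of_set {0..T}) (euclidean_metric :: 'v metric)"
  note mspace_cfunspace [simp del]
  interpret C: Metric_space "mspace ?C" "mdist ?C" by (rule Metric_space_mspace_mdist)
  have memC: "\<Phi> z \<in> mspace ?C" if "z \<in> topspace X" for z
    using mem[OF that] unfolding C_top_def by simp
  show ?thesis
    unfolding C_top_def mtopology_of_def C.continuous_map_to_metric
  proof (intro ballI allI impI)
    fix z and e :: real assume z: "z \<in> topspace X" and e: "0 < e"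
    then obtain U where U: "openin X U" "z \<in> U"
      "\<And>w s. w \<in> U \<Longrightarrow> s \<in> {0..T} \<Longrightarrow> dist (\<Phi> z s) (\<Phi> w s) \<le> e / 2"
      using nbhd[OF z, of "e / 2"] by auto
    have "\<Phi> w \<in> C.mball (\<Phi> z) e" if w: "w \<in> U" for w
    proof -
      have "mdist ?C (\<Phi> z) (\<Phi> w) \<le> e / 2"
        using U(3)[OF w] e by (intro mdist_cfunspace_le) auto
      moreover have "w \<in> topspace X" using U(1) w openin_subset by blast
      ultimately show ?thesis using memC z e by simp
    qed
    then show "\<exists>U. openin X U \<and> z \<in> U \<and> (\<forall>w\<in>U. \<Phi> w \<in> C.mball (\<Phi> z) e)"
      using U by blast
  qed
qed

section \<open>Closedness of the sublevel sets of the BV norm\<close>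

text \<open>Moving \<open>norm (\<eta> 0)\<close> into the supremum presents the BV norm as a
  supremum of one real functional per partition.\<close>

lemma BV_norm_greater_iff:
  assumes "0 \<le> T"
  shows "c < BV_norm T \<eta> \<longleftrightarrow> (\<exists>(k, t)\<in>partitions 0 T.
    c < ennreal (norm (\<eta> 0) + (\<Sum>i<k. norm (\<eta> (t (Suc i)) - \<eta> (t i)))))"
proof -
  have "BV_norm T \<eta> = (SUP p\<in>partitions 0 T. ennreal (norm (\<eta> 0)) +
      (case p of (k, t) \<Rightarrow> ennreal (\<Sum>i<k. norm (\<eta> (t (Suc i)) - \<eta> (t i)))))"
    unfolding BV_norm_def total_variation_def
    by (rule ennreal_SUP_add_right[OF partitions_nonempty[OF assms]])
  also have "\<dots> = (SUP (k, t)\<in>partitions 0 T.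
      ennreal (norm (\<eta> 0) + (\<Sum>i<k. norm (\<eta> (t (Suc i)) - \<eta> (t i)))))"
    by (intro SUP_cong refl) (auto simp: ennreal_plus sum_nonneg)
  finally show ?thesis by (simp only: less_SUP_iff case_prod_unfold)
qed

text \<open>For a fixed partition the functional uses only finitely many evaluations of
  \<open>\<eta>\<close> and is therefore continuous; the set is a union of open preimages.\<close>

lemma openin_BV_norm_greater:
  assumes "0 \<le> T"
  shows "openin (C_top T) {\<eta> \<in> topspace (C_top T). c < BV_norm T \<eta>}"
proof -
  let ?g = "\<lambda>k t \<eta>. norm (\<eta> 0) + (\<Sum>i<k. norm (\<eta> (t (Suc i)) - \<eta> (t i)))"
  have "{\<eta> \<in> topspace (C_top T). c < BV_norm T \<eta>} =
    (\<Union>(k, t)\<in>partitions 0 T. {\<eta> \<in> topspace (C_top T). ?g k t \<eta> \<in> {r. c < ennreal r}})"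
    unfolding BV_norm_greater_iff[OF assms] by fastforce
  also have "openin (C_top T) \<dots>"
  proof (rule openin_Union, clarify)
    fix k t assume "(k, t) \<in> partitions 0 T"
    then have t: "\<And>i. i < k \<Longrightarrow> t i \<le> t (Suc i)" "t 0 = 0" "t k = T"
      by (auto simp: partitions_def less_imp_le)
    have "t i \<in> {0..T}" if "i \<le> k" for i
      using monotone_steps_bounds[of k t i] t that by auto
    then have "continuous_map (C_top T) euclideanreal (?g k t)"
      using assms
      by (intro continuous_map_add continuous_map_norm continuous_map_sum continuous_map_diff
          continuous_map_eval) auto
    moreover have "open {r. c < ennreal r}"
      by (intro open_Collect_less continuous_on_const continuous_on_ennreal continuous_on_id)
    ultimately show "openin (C_top T) {\<eta> \<in> topspace (C_top T). ?g k t \<eta> \<in> {r. c < ennreal r}}"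
      by (intro openin_continuous_map_preimage) auto
  qed
  finally show ?thesis .
qed

lemma closedin_BV_norm_le:
  assumes "0 \<le> T"
  shows "closedin (C_top T) {\<eta> \<in> topspace (C_top T). BV_norm T (\<eta> :: real \<Rightarrow> 'v :: real_normed_vector) \<le> c}"
proof -
  have "{\<eta> \<in> topspace (C_top T). BV_norm T (\<eta> :: real \<Rightarrow> 'v :: real_normed_vector) \<le> c} =
      topspace (C_top T) - {\<eta> \<in> topspace (C_top T). c < BV_norm T (\<eta> :: real \<Rightarrow> 'v)}"
    by (auto simp: not_less)
  then show ?thesis
    using closedin_diff[OF closedin_topspace openin_BV_norm_greater[OF assms, of c]] by (simp only:)
qed

text \<open>Integer levels exhaust the paths of bounded variation, which makes the exhaustion
  countable.\<close>

lemma bounded_variation_iff_BV_norm: "bounded_variation T \<eta> \<longleftrightarrow> (\<exists>k. BV_norm T \<eta> \<le> ennreal (real k))"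
proof
  assume "bounded_variation T \<eta>"
  then have "BV_norm T \<eta> < \<infinity>" unfolding bounded_variation_def BV_norm_def by simp
  then obtain k where "BV_norm T \<eta> < of_nat k"
    using ennreal_Ex_less_of_nat by auto
  then show "\<exists>k. BV_norm T \<eta> \<le> ennreal (real k)"
    by (auto simp: ennreal_of_nat_eq_real_of_nat intro!: exI[of _ k])
next
  assume "\<exists>k. BV_norm T \<eta> \<le> ennreal (real k)"
  then have "BV_norm T \<eta> < \<infinity>" using le_less_trans by fastforce
  then show "bounded_variation T \<eta>" unfolding bounded_variation_def BV_norm_def by simp
qed

section \<open>Continuity and measurability of the integral map\<close>

lemma total_variation_component_le:
  fixes \<eta> :: "real \<Rightarrow> real ^ 'd"
  shows "total_variation a b (\<lambda>s. \<eta> s $ i) \<le> total_variation a b \<eta>"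
  unfolding total_variation_def
proof (rule SUP_mono, clarify)
  fix k t assume "(k, t) \<in> partitions a b"
  moreover have "norm (\<eta> (t (Suc j)) $ i - \<eta> (t j) $ i) \<le> norm (\<eta> (t (Suc j)) - \<eta> (t j))" for j
    using Finite_Cartesian_Product.norm_nth_le[of "\<eta> (t (Suc j)) - \<eta> (t j)" i] by simp
  ultimately show "\<exists>p\<in>partitions a b.
     ennreal (\<Sum>j<k. norm (\<eta> (t (Suc j)) $ i - \<eta> (t j) $ i))
     \<le> (case p of (k, t) \<Rightarrow> ennreal (\<Sum>j<k. norm (\<eta> (t (Suc j)) - \<eta> (t j))))"
    by (intro bexI[of _ "(k, t)"]) (auto intro!: ennreal_leI sum_mono)
qed

lemma component_dist_le: "\<bar>x $ i - y $ i\<bar> \<le> dist x (y :: real ^ 'd)"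
  using component_le_norm_cart[of "x - y" i] by (simp add: dist_norm)

lemma integral_process_in_C_top:
  fixes x \<eta> :: "real \<Rightarrow> real ^ 'd"
  assumes T: "0 < T" and x: "x \<in> topspace (C_top T)" and \<eta>: "\<eta> \<in> topspace (C_top T)"
  shows "integral_process T x \<eta> \<in> topspace (C_top T)"
proof -
  have "continuous_on {0..T} (\<lambda>t. if bounded_variation T \<eta>
     then \<Sum>i\<in>UNIV. stieltjes_integral T (\<lambda>s. x s $ i) (\<lambda>s. \<eta> s $ i) t else 0)"
  proof (cases "bounded_variation T \<eta>")
    case True
    have "continuous_on {0..T} (stieltjes_integral T (\<lambda>s. x s $ i) (\<lambda>s. \<eta> s $ i))" for i
    proof -
      interpret continuous_BV_path T "\<lambda>s. \<eta> s $ i"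
        by unfold_locales (use T \<eta> True total_variation_component_le[of 0 T \<eta> i] in
          \<open>auto simp: topspace_C_top bounded_variation_def intro!: continuous_on_component
            intro: le_less_trans\<close>)
      show ?thesis
        using x by (intro stieltjes_integral_continuous continuous_on_component) (auto simp: topspace_C_top)
    qed
    then show ?thesis using True by (auto intro!: continuous_on_sum)
  qed simp
  then show ?thesis

    by (simp only: integral_process_def topspace_C_top mem_Collect_eq continuous_on_restrict_iff
        restrict_extensional)
qed

abbreviation BV_sublevel :: "real \<Rightarrow> real \<Rightarrow> ((real \<Rightarrow> real ^ 'd) \<times> (real \<Rightarrow> real ^ 'd)) set" where
  "BV_sublevel T K \<equiv> topspace (C_top T) \<times> {\<eta> \<in> topspace (C_top T). BV_norm T \<eta> \<le> ennreal K}"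

text \<open>Each component has variation at most \<open>K\<close>, so scalar joint continuity
  applies to each coordinate and the finitely many errors are added.\<close>

lemma integral_process_continuous_on_BV_sublevel:
  assumes T: "0 < T" and K: "0 \<le> K"
  shows "continuous_map (subtopology (prod_topology (C_top T) (C_top T)) (BV_sublevel T K)) (C_top T)
    (\<lambda>(x, \<eta> :: real \<Rightarrow> real ^ 'd). integral_process T x \<eta>)"
proof (rule continuous_map_into_C_top)
  let ?X = "subtopology (prod_topology (C_top T) (C_top T)) (BV_sublevel T K)
    :: ((real \<Rightarrow> real ^ 'd) \<times> (real \<Rightarrow> real ^ 'd)) topology"
  show "0 \<le> T" using T by simp
  fix z assume z: "z \<in> topspace ?X"
  then show "(case z of (x, \<eta>) \<Rightarrow> integral_process T x \<eta>) \<in> topspace (C_top T)"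
    using integral_process_in_C_top[OF T] by auto
  fix e :: real assume e: "0 < e"
  obtain x \<eta> where z_eq: "z = (x, \<eta>)" by force
  have in_top: "x \<in> topspace (C_top T)" "\<eta> \<in> topspace (C_top T)" and \<eta>K: "BV_norm T \<eta> \<le> ennreal K"
    using z by (auto simp: z_eq)
  have contc: "continuous_on {0..T} (\<lambda>s. f s $ i)" if "f \<in> topspace (C_top T)"
    for f :: "real \<Rightarrow> real ^ 'd" and i
    using that by (auto simp: topspace_C_top intro!: continuous_on_component)
  have TVc: "total_variation 0 T (\<lambda>s. f s $ i) \<le> ennreal K" if "BV_norm T f \<le> ennreal K"
    for f :: "real \<Rightarrow> real ^ 'd" and i
  proof -
    have "total_variation 0 T (\<lambda>s. f s $ i) \<le> total_variation 0 T f"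
      by (rule total_variation_component_le)
    also have "\<dots> \<le> BV_norm T f" unfolding BV_norm_def by simp
    finally show ?thesis using that by simp
  qed
  have bv: "bounded_variation T f" if "BV_norm T f \<le> ennreal K" for f :: "real \<Rightarrow> real ^ 'd"
    using that le_less_trans[OF that ennreal_less_top]
    unfolding bounded_variation_def BV_norm_def by simp
  define e' where "e' = e / CARD('d)"
  have e': "0 < e'" using e by (simp add: e'_def)
  \<comment> \<open>The scalar result in object-level quantifiers, so that a radius can be chosen as
    a function of \<open>i\<close>.\<close>
  have "\<exists>d>0. \<forall>x' \<eta>' t. continuous_on {0..T} x' \<longrightarrow> continuous_on {0..T} \<eta>' \<longrightarrow>
      total_variation 0 T \<eta>' \<le> ennreal K \<longrightarrow>
      (\<forall>s\<in>{0..T}. \<bar>x' s - x s $ i\<bar> \<le> d) \<longrightarrow> (\<forall>s\<in>{0..T}. \<bar>\<eta>' s - \<eta> s $ i\<bar> \<le> d) \<longrightarrow>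
      t \<in> {0..T} \<longrightarrow> \<bar>stieltjes_integral T x' \<eta>' t
        - stieltjes_integral T (\<lambda>s. x s $ i) (\<lambda>s. \<eta> s $ i) t\<bar> \<le> e'" for i
    by (rule stieltjes_integral_joint_continuity[OF T contc[OF in_top(1)] contc[OF in_top(2)]
          TVc[OF \<eta>K] K e', of i i]) (intro exI conjI, assumption, blast)
  then obtain d where d: "\<And>i. 0 < d i"
    and d_close: "\<And>i x' \<eta>' t. continuous_on {0..T} x' \<Longrightarrow> continuous_on {0..T} \<eta>' \<Longrightarrow>
      total_variation 0 T \<eta>' \<le> ennreal K \<Longrightarrow>
      (\<forall>s\<in>{0..T}. \<bar>x' s - x s $ i\<bar> \<le> d i) \<Longrightarrow> (\<forall>s\<in>{0..T}. \<bar>\<eta>' s - \<eta> s $ i\<bar> \<le> d i) \<Longrightarrow>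
      t \<in> {0..T} \<Longrightarrow> \<bar>stieltjes_integral T x' \<eta>' t
        - stieltjes_integral T (\<lambda>s. x s $ i) (\<lambda>s. \<eta> s $ i) t\<bar> \<le> e'"
    by metis
  \<comment> \<open>There are finitely many coordinates, so one positive radius works for all of
    them.\<close>
  define D where "D = Min (range d)"
  have D: "0 < D" "\<And>i. D \<le> d i" using d by (auto simp: D_def)
  obtain U where U: "openin (C_top T) U" "x \<in> U"
    "\<And>g s. g \<in> U \<Longrightarrow> s \<in> {0..T} \<Longrightarrow> dist (g s) (x s) \<le> D"
    using C_top_neighbourhood[OF in_top(1) D(1)] by metis
  obtain W where W: "openin (C_top T) W" "\<eta> \<in> W"
    "\<And>g s. g \<in> W \<Longrightarrow> s \<in> {0..T} \<Longrightarrow> dist (g s) (\<eta> s) \<le> D"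
    using C_top_neighbourhood[OF in_top(2) D(1)] by metis
  have close: "dist (integral_process T x \<eta> t) (integral_process T x' \<eta>' t) \<le> e"
    if "x' \<in> U" "\<eta>' \<in> W" and K': "BV_norm T \<eta>' \<le> ennreal K" and t: "t \<in> {0..T}" for x' \<eta>' t
  proof -
    let ?J = "\<lambda>x \<eta> i. stieltjes_integral T (\<lambda>s. x s $ i) (\<lambda>s. \<eta> s $ i) t"
    have in_top': "x' \<in> topspace (C_top T)" "\<eta>' \<in> topspace (C_top T)"
      using that U(1) W(1) openin_subset by blast+
    have J: "\<bar>?J x' \<eta>' i - ?J x \<eta> i\<bar> \<le> e'" for i
    proof (rule d_close[OF contc[OF in_top'(1)] contc[OF in_top'(2)] TVc[OF K'] _ _ t])
      show "\<forall>s\<in>{0..T}. \<bar>x' s $ i - x s $ i\<bar> \<le> d i"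
        using U(3)[OF \<open>x' \<in> U\<close>] D(2)[of i] component_dist_le order_trans by meson
      show "\<forall>s\<in>{0..T}. \<bar>\<eta>' s $ i - \<eta> s $ i\<bar> \<le> d i"
        using W(3)[OF \<open>\<eta>' \<in> W\<close>] D(2)[of i] component_dist_le order_trans by meson
    qed
    have "dist (integral_process T x \<eta> t) (integral_process T x' \<eta>' t) =
      \<bar>\<Sum>i\<in>UNIV. ?J x' \<eta>' i - ?J x \<eta> i\<bar>"
      unfolding integral_process_def using t bv[OF \<eta>K] bv[OF K']
      by (simp add: dist_real_def sum_subtractf abs_minus_commute)
    also have "\<dots> \<le> (\<Sum>i\<in>UNIV. \<bar>?J x' \<eta>' i - ?J x \<eta> i\<bar>)" by (rule sum_abs)
    also have "\<dots> \<le> (\<Sum>i\<in>(UNIV :: 'd set). e')" by (intro sum_mono J)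
    also have "\<dots> = e" by (simp add: e'_def)
    finally show ?thesis .
  qed
  show "\<exists>U. openin ?X U \<and> z \<in> U \<and> (\<forall>w\<in>U. \<forall>s\<in>{0..T}.
      dist ((case z of (x, \<eta>) \<Rightarrow> integral_process T x \<eta>) s)
        ((case w of (x, \<eta>) \<Rightarrow> integral_process T x \<eta>) s) \<le> e)"
  proof (intro exI conjI)
    have "openin (prod_topology (C_top T) (C_top T)) (U \<times> W)"
      using U(1) W(1) by (simp add: openin_prod_Times_iff)
    then show "openin ?X ((U \<times> W) \<inter> BV_sublevel T K)"
      unfolding openin_subtopology by blast
    show "z \<in> (U \<times> W) \<inter> BV_sublevel T K" using U(2) W(2) in_top \<eta>K by (simp add: z_eq)
    show "\<forall>w\<in>(U \<times> W) \<inter> BV_sublevel T K. \<forall>s\<in>{0..T}.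
      dist ((case z of (x, \<eta>) \<Rightarrow> integral_process T x \<eta>) s)
        ((case w of (x, \<eta>) \<Rightarrow> integral_process T x \<eta>) s) \<le> e"
      using close by (auto simp: z_eq)
  qed
qed

lemma closedin_BV_sublevel:
  "0 \<le> T \<Longrightarrow> closedin (prod_topology (C_top T) (C_top T)) (BV_sublevel T K)"
  by (simp add: closedin_prod_Times_iff closedin_BV_norm_le)

text \<open>Off the countable union of sublevel sets the integrator has unbounded variation, and the
  convention makes the integral the zero path.\<close>

lemma integral_process_measurable:
  assumes T: "0 < T"
  shows "(\<lambda>(x, \<eta> :: real \<Rightarrow> real ^ 'd). integral_process T x \<eta>)
    \<in> measurable (borel_of_top (prod_topology (C_top T) (C_top T))) (borel_of_top (C_top T))"
proof (rule measurable_piecewise_continuous_map)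
  show "closedin (prod_topology (C_top T) (C_top T)) (BV_sublevel T (real k))" for k
    using T by (simp add: closedin_BV_sublevel)
  show "continuous_map (subtopology (prod_topology (C_top T) (C_top T)) (BV_sublevel T (real k)))
    (C_top T) (\<lambda>(x, \<eta> :: real \<Rightarrow> real ^ 'd). integral_process T x \<eta>)" for k
    by (rule integral_process_continuous_on_BV_sublevel[OF T]) simp
  show "(case z of (x, \<eta>) \<Rightarrow> integral_process T x \<eta>) = (\<lambda>t\<in>{0..T}. 0)"
    if "z \<in> topspace (prod_topology (C_top T) (C_top T))" "z \<notin> (\<Union>k. BV_sublevel T (real k))"
    for z :: "(real \<Rightarrow> real ^ 'd) \<times> (real \<Rightarrow> real ^ 'd)"
  proof -
    have "\<not> bounded_variation T (snd z)"
      unfolding bounded_variation_iff_BV_norm using that by auto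
    then show ?thesis by (simp add: integral_process_def case_prod_unfold)
  qed
  show "(\<lambda>t\<in>{0..T}. 0 :: real) \<in> topspace (C_top T)"

    by (simp only: topspace_C_top mem_Collect_eq continuous_on_restrict_iff restrict_extensional
        continuous_on_const)
qed

text \<open>Measurability of the integral processes appears as separate conjuncts because
  \<open>converges_in_distribution\<close> does not include it.\<close>

theorem proposition8:
  fixes T :: real
    and P :: "nat \<Rightarrow> 'a measure" and Q :: "'b measure"
    and X H :: "nat \<Rightarrow> 'a \<Rightarrow> real \<Rightarrow> real ^ 'd"
    and X' H' :: "'b \<Rightarrow> real \<Rightarrow> real ^ 'd"
  assumes "T > 0"
    and "\<And>n. n \<ge> 1 \<Longrightarrow> prob_space (P n)"
    and "prob_space Q"
    and "\<And>n. n \<ge> 1 \<Longrightarrow>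
           (\<lambda>\<omega>. (X n \<omega>, H n \<omega>)) \<in> measurable (P n) (borel_of_top (prod_topology (C_top T) (C_top T)))"
    and "(\<lambda>\<omega>. (X' \<omega>, H' \<omega>)) \<in> measurable Q (borel_of_top (prod_topology (C_top T) (C_top T)))"
    and "converges_in_distribution (prod_topology (C_top T) (C_top T))
           P (\<lambda>n \<omega>. (X n \<omega>, H n \<omega>)) Q (\<lambda>\<omega>. (X' \<omega>, H' \<omega>))"
    and "\<And>n. n \<ge> 1 \<Longrightarrow> AE \<omega> in P n. bounded_variation T (H n \<omega>)"
    and "((\<lambda>\<nu>. SUP n\<in>{1..}. measure (P n) {\<omega> \<in> space (P n). BV_norm T (H n \<omega>) > ennreal \<nu>})
           \<longlongrightarrow> 0) at_top"
  shows "(AE \<omega> in Q. bounded_variation T (H' \<omega>)) \<and>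
         (\<forall>n\<ge>1. (\<lambda>\<omega>. integral_process T (X n \<omega>) (H n \<omega>)) \<in> measurable (P n) (borel_of_top (C_top T))) \<and>
         (\<lambda>\<omega>. integral_process T (X' \<omega>) (H' \<omega>)) \<in> measurable Q (borel_of_top (C_top T)) \<and>
         converges_in_distribution (C_top T)
           P (\<lambda>n \<omega>. integral_process T (X n \<omega>) (H n \<omega>))
           Q (\<lambda>\<omega>. integral_process T (X' \<omega>) (H' \<omega>))"
proof -
  note T = assms(1) and P = assms(2) and Q = assms(3) and Z = assms(4) and Y = assms(5)
    and conv = assms(6)
  let ?S = "prod_topology (C_top T) (C_top T) :: ((real \<Rightarrow> real ^ 'd) \<times> (real \<Rightarrow> real ^ 'd)) topology"
  let ?A = "\<lambda>k. BV_sublevel T (real k) :: ((real \<Rightarrow> real ^ 'd) \<times> (real \<Rightarrow> real ^ 'd)) set"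
  interpret Q: prob_space Q by (rule Q)
  have metrizable: "metrizable_space ?S"
    by (simp add: metrizable_space_prod_topology metrizable_C_top)
  have closed: "closedin ?S (?A k)" for k using T by (simp add: closedin_BV_sublevel)
  note cont = integral_process_continuous_on_BV_sublevel[OF T of_nat_0_le_iff]
  note meas = integral_process_measurable[OF T]
  have tight: "\<exists>k. \<forall>n\<ge>1. measure (P n) {\<omega> \<in> space (P n). (X n \<omega>, H n \<omega>) \<notin> ?A k} \<le> e"
    if e: "0 < e" for e
  proof -
    let ?p = "\<lambda>\<nu> n. measure (P n) {\<omega> \<in> space (P n). BV_norm T (H n \<omega>) > ennreal \<nu>}"
    have "\<forall>\<^sub>F \<nu> in at_top. (SUP n\<in>{1..}. ?p \<nu> n) < e"
      using order_tendstoD(2)[OF assms(8) e] .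
    then obtain N where N: "\<And>\<nu>. \<nu> \<ge> N \<Longrightarrow> (SUP n\<in>{1..}. ?p \<nu> n) < e"
      unfolding eventually_at_top_linorder by auto
    obtain k where k: "N \<le> real k" using real_arch_simple by blast
    show ?thesis
    proof (intro exI[of _ k] allI impI)
      fix n :: nat assume n: "n \<ge> 1"
      \<comment> \<open>The supremum of reals dominates its members only for a bounded family;
        probabilities are at most \<open>1\<close>.\<close>
      have "bdd_above (?p (real k) ` {1..})"
        using prob_space.prob_le_1[OF P] by (intro bdd_aboveI[of _ 1]) auto
      then have "?p (real k) n \<le> (SUP n\<in>{1..}. ?p (real k) n)"
        using n by (intro cSUP_upper) auto
      \<comment> \<open>By measurability both paths lie in the path space, so leaving
        \<open>?A k\<close> can only mean that the norm bound fails.\<close>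
      moreover have "{\<omega> \<in> space (P n). (X n \<omega>, H n \<omega>) \<notin> ?A k} =
        {\<omega> \<in> space (P n). BV_norm T (H n \<omega>) > ennreal (real k)}"
        using measurable_space[OF Z[OF n]] by (auto simp: not_le)
      ultimately show "measure (P n) {\<omega> \<in> space (P n). (X n \<omega>, H n \<omega>) \<notin> ?A k} \<le> e"
        using N[OF k] by simp
    qed
  qed
  have "AE \<omega> in Q. bounded_variation T (H' \<omega>)"
  proof (rule AE_I)
    let ?E = "{\<omega> \<in> space Q. (X' \<omega>, H' \<omega>) \<notin> (\<Union>k. ?A k)}"
    show "{\<omega> \<in> space Q. \<not> bounded_variation T (H' \<omega>)} \<subseteq> ?E"
      unfolding bounded_variation_iff_BV_norm by auto
    have sets: "{\<omega> \<in> space Q. (X' \<omega>, H' \<omega>) \<notin> ?A k} \<in> sets Q" for k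
    proof -
      have "{\<omega> \<in> space Q. (X' \<omega>, H' \<omega>) \<notin> ?A k} =
          space Q - ((\<lambda>\<omega>. (X' \<omega>, H' \<omega>)) -` ?A k \<inter> space Q)" by auto
      also have "\<dots> \<in> sets Q"
        using measurable_sets[OF Y closedin_in_sets_borel_of_top[OF closed]] by (rule sets.compl_sets)
      finally show ?thesis .
    qed
    have "?E = (\<Inter>k. {\<omega> \<in> space Q. (X' \<omega>, H' \<omega>) \<notin> ?A k})" by auto
    also have "\<dots> \<in> sets Q" by (rule sets.countable_INT) (use sets in auto)
    finally show E: "?E \<in> sets Q" .
    \<comment> \<open>\<open>?E\<close> lies in the complement of every \<open>?A k\<close>, and the
      limit inherits the bound \<open>e\<close> there. The summand \<open>0\<close> fits the shape
      of \<open>field_le_epsilon\<close>.\<close>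
    have "measure Q ?E \<le> 0 + e" if e: "0 < e" for e
    proof -
      obtain k where k: "\<And>n. n \<ge> 1 \<Longrightarrow>
          measure (P n) {\<omega> \<in> space (P n). (X n \<omega>, H n \<omega>) \<notin> ?A k} \<le> e"
        using tight[OF e] by blast
      have "measure Q ?E \<le> measure Q {\<omega> \<in> space Q. (X' \<omega>, H' \<omega>) \<notin> ?A k}"
        by (rule Q.finite_measure_mono[OF _ sets]) auto
      also have "\<dots> \<le> e"
        by (rule limit_law_closed_complement_bound[OF metrizable P Q Z Y conv closed k])
      finally show ?thesis by simp
    qed
    then have "measure Q ?E \<le> 0" by (rule field_le_epsilon)
    then show "emeasure Q ?E = 0" by (simp add: Q.emeasure_eq_measure measure_le_0_iff)
  qed
  moreover have "(\<lambda>\<omega>. integral_process T (X n \<omega>) (H n \<omega>)) \<in> measurable (P n) (borel_of_top (C_top T))"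
    if "n \<ge> 1" for n
    using measurable_compose[OF Z[OF that] meas] by simp
  moreover have "(\<lambda>\<omega>. integral_process T (X' \<omega>) (H' \<omega>)) \<in> measurable Q (borel_of_top (C_top T))"
    using measurable_compose[OF Y meas] by simp
  moreover have "converges_in_distribution (C_top T)
           P (\<lambda>n \<omega>. integral_process T (X n \<omega>) (H n \<omega>))
           Q (\<lambda>\<omega>. integral_process T (X' \<omega>) (H' \<omega>))"
    using continuous_mapping_on_closed_exhaustion[OF metrizable P Q Z Y conv closed cont meas tight]
    by simp
  ultimately show ?thesis by blast
qed

end
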